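(* Let $\mathcal{A}\in\mathbb{R}^{[m,n]}$ be a $Z$-tensor and $b\in\mathbb{R}^n$ with $b\ge 0$. Let $I_0=\{i\in[n] \mid b_i=0\}$ and suppose that $\mathcal{S}_g=\{x\in\mathbb{R}^n\mid x\ge 0,\ \mathcal{A}x^{m-1}\ge b\}\ne\emptyset$. Let $\mathcal{A}=\mathcal{M}-\mathcal{N}$ be the level-1 splitting, $M$ the majorization matrix of $\mathcal{A}$, $M=P-Q$ with $P$ a nonsingular $M$-matrix and $Q\ge 0$, and let $\mathcal{L}$ be the associated nonnegative tensor with $\mathcal{L}x^{m-1}=Qx^{[m-1]}+\mathcal{N}x^{m-1}$. Let $\{x_k\}$ be the sequence of nonnegative vectors given by $x_0=0$ and $$P x_{k+1}^{[m-1]}=\mathcal{L}x_k^{m-1}+b,\qquad k\ge 0.$$ 1. If $I_0=[n]$, then $x_0=0$ is already the minimal nonnegative solution of $\mathcal{A}x^{m-1}=b$. 2. If $I_0=\emptyset$, then $\{x_k\}$ converges linearly to the minimal nonnegative solution (which is actually the unique positive solution) of $\mathcal{A}x^{m-1}=b$. 3. Suppose $I_0$ is a proper subset of $[n]$, and let $k_0$ be the smallest integer such that $x_{k_0}$ and $x_{k_0+1}$ have the same zero pattern. Then $1\le k_0\le n$, and the $x_k$ have the same zero pattern for all $k\ge k_0$, which is also the zero pattern of the minimal nonnegative solution $x_{\min}$ of $\mathcal{A}x^{m-1}=b$. Let $I=\{i\mid (x_{k_0})_i=0\}$. Then $I\subseteq I_0$. Let $I_c=[n]\setminus I$. Then the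 iteration for $k\ge k_0$ is reduced to the iteration $$P_{I_c}\hat{x}_{k+1}^{[m-1]}=\mathcal{L}_{I_c}\hat{x}_k^{m-1}+b_{I_c},\quad k\ge k_0,\qquad \hat{x}_{k_0}=(x_{k_0})_{I_c},$$ for the lower-dimensional tensor equation $\mathcal{A}_{I_c}\hat{x}^{m-1}=b_{I_c}$; that is, $\hat{x}_k=(x_k)_{I_c}$ for all $k\ge k_0$. The minimal nonnegative solution $\hat{x}_{\min}$ of $\mathcal{A}_{I_c}\hat{x}^{m-1}=b_{I_c}$ is positive and equals $(x_{\min})_{I_c}$. Thus $x_k$ converges to $x_{\min}$ linearly if and only if $\hat{x}_k$ converges to $\hat{x}_{\min}$ linearly. All diagonal elements of $\mathcal{A}_{I_c}$ are positive. Write $\hat{\mathcal{A}}=\mathcal{A}_{I_c}$, $\hat{b}=b_{I_c}$, $\hat{P}=P_{I_c}$, $\hat{\mathcal{L}}=\mathcal{L}_{I_c}$ and $\hat{I}_0=I_0\cap I_c$. Then $\hat{x}_k$ converges to $\hat{x}_{\min}$ linearly under any of the following four conditions: (a) $\hat{P}^{-1}\hat{b}>0$. (b) $\hat{P}^{-1}\bar{\hat{\mathcal{L}}}e^{m-2}$ is irreducible, where $e$ is the vector of ones and $\bar{\hat{\mathcal{L}}}$ is the semi-symmetric tensor from $\hat{\mathcal{L}}$. (c) All diagonal elements of $\hat{\mathcal{A}}$ are included entirely in $\hat{P}$ (i.e. $\hat{P}$ has diagonal entries $a_{ii\ldots i}$, $i\in I_c$) and, with $\hat{\mathcal{B}}=\hat{\mathcal{D}}-\hat{\mathcal{A}}$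 where $\hat{\mathcal{D}}$ is the diagonal part of $\hat{\mathcal{A}}$, the matrix $\bar{\hat{\mathcal{B}}}e^{m-2}$ is strictly upper or strictly lower triangular. (d) For each $i\in\hat{I}_0$, there is an element $a_{ii_2\ldots i_m}\ne 0$ with $i_2,\ldots,i_m\in I_c$, where $i_j\notin I_0$ for at least one $j$ ($2\le j\le m$).
   Context: $\mathbb{R}^{[m,n]}$ ($m\ge 2$, $n\ge 1$) is the set of real $m$th-order $n$-dimensional tensors $\mathcal{A}=(a_{i_1i_2\ldots i_m})$, $1\le i_1,\ldots,i_m\le n$; $[n]=\{1,\ldots,n\}$. For $x\in\mathbb{R}^n$, $\mathcal{A}x^{m-1}\in\mathbb{R}^n$ has entries $(\mathcal{A}x^{m-1})_i=\sum_{i_2,\ldots,i_m=1}^n a_{ii_2\ldots i_m}x_{i_2}\cdots x_{i_m}$, and $\mathcal{A}x^{m-2}\in\mathbb{R}^{n\times n}$ has entries $(\mathcal{A}x^{m-2})_{ij}=\sum_{i_3,\ldots,i_m=1}^n a_{iji_3\ldots i_m}x_{i_3}\cdots x_{i_m}$. Diagonal elements are $a_{ii\ldots i}$; all others are off-diagonal; the diagonal part of $\mathcal{A}$ keeps the diagonal elements and has zeros elsewhere. $\mathcal{A}$ is a $Z$-tensor if all its off-diagonal elements are nonpositive. The semi-symmetric tensor $\bar{\mathcal{A}}$ from $\mathcal{A}$ has elements $\bar a_{i_1i_2\ldots i_m}=\frac{1}{(m-1)!}\sum a_{i_1j_2\ldots j_m}$, the sum being over all $(m-1)!$ permutations $j_2\ldots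 j_m$ of $i_2\ldots i_m$. Inequalities for vectors, matrices and tensors are entrywise. For $r>0$, $x^{[r]}$ is the entrywise power, $(x^{[r]})_i=(x_i)^r$. A minimal nonnegative solution is a solution $x$ with $0\le x\le y$ for every solution $y\ge 0$. Level-1 splitting: $\mathcal{A}=\mathcal{M}-\mathcal{N}$, where $\mathcal{M}$ has elements $m_{ij\ldots j}=a_{ij\ldots j}$ for all $i,j\in[n]$ and all other elements zero. The majorization matrix $M$ of $\mathcal{A}$ has $(i,j)$ entry $a_{ij\ldots j}$, so $\mathcal{M}x^{m-1}=Mx^{[m-1]}$. A nonsingular $M$-matrix is a matrix $sI-B$ with $B\ge0$ and $s>\rho(B)$. The tensor $\mathcal{L}$ has elements $\mathcal{L}_{ij\ldots j}=Q_{ij}$ and coincides with $\mathcal{N}$ in all other positions. Explicitly, the iteration is $x_{k+1}=\left(P^{-1}(\mathcal{L}x_k^{m-1}+b)\right)^{[1/(m-1)]}$. For an index set $J\subseteq[n]$, $x_J$ is the subvector of $x$ with elements $x_i$, $i\in J$; $\mathcal{A}_J$ is the subtensor with elements $a_{i_1\ldots i_m}$, $i_1,\ldots,i_m\in J$; and $P_J$ is the principal submatrix with indices in $J$. The zero pattern of a vector is the set of indices of its zero elements. Linear convergence means at least linear convergence: $\{x_k\}$ converges linearly to $x_*$ if there are constants $C>0$ and $r\in(0,1)$ with $\|x_k-x_*\|\le C r^k$ for all $k$. *)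

theory Defs
  imports
    "Jordan_Normal_Form.Spectral_Radius"
    "Jordan_Normal_Form.Gauss_Jordan_Elimination"
    "Jordan_Normal_Form.DL_Submatrix"
    "HOL-Combinatorics.Permutations"
begin

text \<open>
  Indices are 0-based, so the index set of dimension \<open>n\<close> is \<open>{..<n}\<close>.
  A real tensor of order \<open>m\<close> and dimension \<open>n\<close> is a function on index lists; only its
  values on lists of length \<open>m\<close> with entries below \<open>n\<close> are meaningful, and the notions
  below that depend on \<open>m\<close> or \<open>n\<close> take them as arguments.
\<close>

type_synonym tensor = "nat list \<Rightarrow> real"

definition tuples :: "nat \<Rightarrow> nat \<Rightarrow> nat list set" where
  "tuples n k = {is. length is = k \<and> set is \<subseteq> {..<n}}"

definition tensor_vec :: "nat \<Rightarrow> nat \<Rightarrow> tensor \<Rightarrow> real vec \<Rightarrow> real vec" where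
  "tensor_vec m n A x =
     vec n (\<lambda>i. \<Sum>is\<in>tuples n (m - 1). A (i # is) * (\<Prod>k<m - 1. x $ (is ! k)))"

definition tensor_mat :: "nat \<Rightarrow> nat \<Rightarrow> tensor \<Rightarrow> real vec \<Rightarrow> real mat" where
  "tensor_mat m n A x =
     mat n n (\<lambda>(i, j). \<Sum>is\<in>tuples n (m - 2). A (i # j # is) * (\<Prod>k<m - 2. x $ (is ! k)))"

definition diag_part :: "nat \<Rightarrow> tensor \<Rightarrow> tensor" where
  "diag_part m A = (\<lambda>is. if \<exists>i. is = replicate m i then A is else 0)"

definition Z_tensor :: "nat \<Rightarrow> nat \<Rightarrow> tensor \<Rightarrow> bool" where
  "Z_tensor m n A \<longleftrightarrow> (\<forall>is\<in>tuples n m. (\<nexists>i. is = replicate m i) \<longrightarrow> A is \<le> 0)"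

text \<open>
  The sum runs over the permutations of the \<open>m - 1\<close> positions, so that rearrangements of
  \<open>i\<^sub>2, \<dots>, i\<^sub>m\<close> that coincide because of repeated indices are counted with multiplicity.
\<close>

definition semi_symmetric :: "nat \<Rightarrow> tensor \<Rightarrow> tensor" where
  "semi_symmetric m A =
     (\<lambda>is. (\<Sum>\<sigma> | \<sigma> permutes {..<m - 1}. A (hd is # permute_list \<sigma> (tl is))) / fact (m - 1))"

definition majorization_mat :: "nat \<Rightarrow> nat \<Rightarrow> tensor \<Rightarrow> real mat" where
  "majorization_mat m n A = mat n n (\<lambda>(i, j). A (i # replicate (m - 1) j))"

definition level1_M :: "nat \<Rightarrow> tensor \<Rightarrow> tensor" where
  "level1_M m A = (\<lambda>is. if \<exists>i j. is = i # replicate (m - 1) j then A is else 0)"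

definition level1_N :: "nat \<Rightarrow> tensor \<Rightarrow> tensor" where
  "level1_N m A = (\<lambda>is. level1_M m A is - A is)"

definition level1_L :: "nat \<Rightarrow> tensor \<Rightarrow> real mat \<Rightarrow> tensor" where
  "level1_L m A Q =
     (\<lambda>is. if \<exists>i j. is = i # replicate (m - 1) j then Q $$ (is ! 0, is ! 1) else level1_N m A is)"

text \<open>
  As for \<^const>\<open>submatrix\<close>, the rows of a subtensor or subvector are the elements of \<open>J\<close>
  in increasing order, \<open>pick J i\<close> being the \<open>i\<close>-th smallest one. A subtensor of a tensor of
  dimension \<open>n\<close> has dimension \<open>card J\<close> for \<open>J \<subseteq> {..<n}\<close>.
\<close>

definition subtensor :: "tensor \<Rightarrow> nat set \<Rightarrow> tensor" where
  "subtensor A J = (\<lambda>is. A (map (pick J) is))"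

definition subvector :: "real vec \<Rightarrow> nat set \<Rightarrow> real vec" where
  "subvector v J = vec (card {i. i < dim_vec v \<and> i \<in> J}) (\<lambda>i. v $ pick J i)"

definition ones_vec :: "nat \<Rightarrow> real vec" where
  "ones_vec n = vec n (\<lambda>_. 1)"

text \<open>
  The library order \<open>\<le>\<close> on vectors and matrices is entrywise (and forces equal dimensions),
  but its strict version \<open><\<close> is not, whence a separate predicate for positivity.
\<close>

definition vec_pos :: "real vec \<Rightarrow> bool" where
  "vec_pos v \<longleftrightarrow> (\<forall>i<dim_vec v. 0 < v $ i)"

definition zero_pattern :: "real vec \<Rightarrow> nat set" where
  "zero_pattern v = {i. i < dim_vec v \<and> v $ i = 0}"

definition vec_power :: "real vec \<Rightarrow> nat \<Rightarrow> real vec" where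
  "vec_power v r = map_vec (\<lambda>t. t ^ r) v"

definition eucl_norm :: "real vec \<Rightarrow> real" where
  "eucl_norm v = sqrt (v \<bullet> v)"

text \<open>Meaningful for invertible matrices only.\<close>

definition mat_inv :: "real mat \<Rightarrow> real mat" where
  "mat_inv A = the (mat_inverse A)"

definition nonsingular_M_matrix :: "real mat \<Rightarrow> bool" where
  "nonsingular_M_matrix P \<longleftrightarrow>
     (\<exists>n s B. B \<in> carrier_mat n n \<and> 0\<^sub>m n n \<le> B \<and>
        spectral_radius (map_mat complex_of_real B) < s \<and> P = s \<cdot>\<^sub>m 1\<^sub>m n - B)"

text \<open>With this definition every \<open>1 \<times> 1\<close> matrix is irreducible.\<close>

definition irreducible_mat :: "real mat \<Rightarrow> bool" where
  "irreducible_mat A \<longleftrightarrow>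
     \<not> (\<exists>S. S \<noteq> {} \<and> S \<subset> {..<dim_row A} \<and> (\<forall>i\<in>S. \<forall>j\<in>{..<dim_row A} - S. A $$ (i, j) = 0))"

definition strictly_upper_triangular :: "real mat \<Rightarrow> bool" where
  "strictly_upper_triangular A \<longleftrightarrow> (\<forall>i<dim_row A. \<forall>j<dim_col A. j \<le> i \<longrightarrow> A $$ (i, j) = 0)"

definition strictly_lower_triangular :: "real mat \<Rightarrow> bool" where
  "strictly_lower_triangular A \<longleftrightarrow> (\<forall>i<dim_row A. \<forall>j<dim_col A. i \<le> j \<longrightarrow> A $$ (i, j) = 0)"

definition min_nonneg_solution :: "nat \<Rightarrow> nat \<Rightarrow> tensor \<Rightarrow> real vec \<Rightarrow> real vec \<Rightarrow> bool" where
  "min_nonneg_solution m n A b x \<longleftrightarrow>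
     x \<in> carrier_vec n \<and> 0\<^sub>v n \<le> x \<and> tensor_vec m n A x = b \<and>
     (\<forall>y\<in>carrier_vec n. 0\<^sub>v n \<le> y \<and> tensor_vec m n A y = b \<longrightarrow> x \<le> y)"

text \<open>
  \<open>x\<close> is a sequence of nonnegative vectors, started at index \<open>k\<^sub>0\<close> with \<open>u\<close> and following the
  iteration from there on; its values before \<open>k\<^sub>0\<close> are unconstrained. Likewise for the
  linear convergence of a sequence indexed by \<open>k \<ge> k\<^sub>0\<close>.
\<close>

definition iteration_from ::
  "nat \<Rightarrow> real vec \<Rightarrow> nat \<Rightarrow> nat \<Rightarrow> real mat \<Rightarrow> tensor \<Rightarrow> real vec \<Rightarrow> (nat \<Rightarrow> real vec) \<Rightarrow> bool" where
  "iteration_from k0 u m n P L b x \<longleftrightarrow>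
     x k0 = u \<and>
     (\<forall>k\<ge>k0. x k \<in> carrier_vec n \<and> 0\<^sub>v n \<le> x k) \<and>
     (\<forall>k\<ge>k0. P *\<^sub>v vec_power (x (Suc k)) (m - 1) = tensor_vec m n L (x k) + b)"

definition linearly_convergent_from :: "nat \<Rightarrow> (nat \<Rightarrow> real vec) \<Rightarrow> real vec \<Rightarrow> bool" where
  "linearly_convergent_from k0 x l \<longleftrightarrow>
     (\<exists>C r. 0 < C \<and> 0 < r \<and> r < 1 \<and> (\<forall>k\<ge>k0. eucl_norm (x k - l) \<le> C * r ^ k))"

end

theory Submission
  imports Defs
begin

text \<open>
  Every \<open>y \<ge> 0\<close> with \<open>A y\<^sup>m\<^sup>-\<^sup>1 \<ge> b\<close> dominates the iterates, which increase; so they converge to the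
  minimal nonnegative solution, and the zero pattern of \<open>x\<^sub>k\<^sub>+\<^sub>1\<close> depends only on that of \<open>x\<^sub>k\<close>.

  For linear convergence put \<open>u = x\<^sup>[\<^sup>m\<^sup>-\<^sup>1\<^sup>]\<close>. The iteration becomes \<open>u \<mapsto> P\<^sup>-\<^sup>1(F(u) + b)\<close> with \<open>F\<close>
  monotone and homogeneous of degree one. If \<open>u\<^sub>k \<ge> (1 - t) u\<^sub>*\<close> for a positive fixed point
  \<open>u\<^sub>*\<close>, then \<open>u\<^sub>k\<^sub>+\<^sub>1 \<ge> (1 - t) u\<^sub>* + t P\<^sup>-\<^sup>1 b\<close>, so the coordinates in the support of \<open>P\<^sup>-\<^sup>1 b\<close> gain a
  fixed proportion of \<open>t\<close>. A gain is passed on to every coordinate that depends on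
  one with a gain, and once it has reached all coordinates there is a contraction factor for a fixed
  number of steps. Under condition (c) the iteration is triangular and terminates.
\<close>

subsection \<open>Monotone tensor iterations\<close>

text \<open>The obstacle is the root in the iteration: it may fail to be differentiable at zero
  coordinates of the limit, and a Jacobian argument at a positive limit would call for
  Perron-Frobenius theory. Multiplicative comparison in the powers avoids derivatives, but it needs
  a positive start below a positive solution. Since \<open>x 0 = 0\<close>, it can only begin once
  the zero pattern has settled, and only after the coordinates that stay zero are deleted. All
  hypotheses must therefore survive restriction to an index set. For the matrix this is arranged by
  replacing the spectral condition with a vector \<open>z > 0\<close> satisfying
  \<open>P z > 0\<close>; for the tensors, by an entrywise relation between \<open>A\<close>,
  \<open>P\<close> and \<open>L\<close>. Vectors and matrices become functions on indices, and
  \<open>r\<close> stands for \<open>m - 1\<close>, so one set of locales serves both the full and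
  the reduced system. The geometric bound holds for every positive solution above the iterates, not
  only for the minimal one; this also yields uniqueness when \<open>b\<close> is positive.\<close>

definition tensor_form :: "nat \<Rightarrow> nat \<Rightarrow> tensor \<Rightarrow> (nat \<Rightarrow> real) \<Rightarrow> nat \<Rightarrow> real" where
  "tensor_form n r L x i = (\<Sum>is\<in>tuples n r. L (i # is) * (\<Prod>k<r. x (is ! k)))"

lemma finite_tuples [simp, intro]: "finite (tuples n r)"
proof -
  have "tuples n r = {is. set is \<subseteq> {..<n} \<and> length is = r}"
    by (auto simp: tuples_def)
  then show ?thesis
    using finite_lists_length_eq[of "{..<n}" r] by simp
qed

lemma tuples_nth: "is \<in> tuples n r \<Longrightarrow> k < r \<Longrightarrow> is ! k < n"
  by (force simp: tuples_def dest: nth_mem)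

lemma tuples_mem: "is \<in> tuples n r \<Longrightarrow> j \<in> set is \<Longrightarrow> j < n"
  by (auto simp: tuples_def)

lemma tensor_form_cong:
  assumes "\<And>j. j < n \<Longrightarrow> x j = y j"
  shows "tensor_form n r L x i = tensor_form n r L y i"
  unfolding tensor_form_def using assms
  by (intro sum.cong prod.cong refl arg_cong2[where f = "(*)"]) (auto intro: tuples_nth)

lemma tensor_form_tendsto:
  assumes "\<And>j. j < n \<Longrightarrow> (\<lambda>k. x k j) \<longlonglongrightarrow> xs j"
  shows "(\<lambda>k. tensor_form n r L (x k) i) \<longlonglongrightarrow> tensor_form n r L xs i"
  unfolding tensor_form_def using assms
  by (intro tendsto_sum tendsto_mult tendsto_const tendsto_prod) (auto intro: tuples_nth)

text \<open>Turns a gain in an \<open>r\<close>-th power into a gain of the coordinate without any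
  calculus of roots. On \<open>[0, 1]\<close> the convex function \<open>(1 + w) ^ r\<close> lies
  below its chord of slope \<open>2 ^ r - 1\<close>, which is where the constant
  \<open>2 ^ r\<close> comes from.\<close>

lemma one_plus_pow_le:
  fixes u :: real
  assumes "0 \<le> u" "u \<le> 1"
  shows "(1 + u / 2 ^ r) ^ r \<le> 1 + u"
proof -
  have bound: "(1 + w) ^ r \<le> 1 + (2 ^ r - 1) * w" if w: "0 \<le> w" "w \<le> 1" for w :: real and r
  proof (induction r)
    case (Suc r)
    have "(1 + w) ^ Suc r \<le> (1 + w) * (1 + (2 ^ r - 1) * w)"
      using Suc w by (simp add: mult_left_mono)
    also have "\<dots> = 1 + 2 ^ r * w + (2 ^ r - 1) * (w * w)"
      by (simp add: algebra_simps)
    also have "\<dots> \<le> 1 + 2 ^ r * w + (2 ^ r - 1) * w"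
      using w mult_left_mono[of w 1 w] by (intro add_left_mono mult_left_mono) auto
    also have "\<dots> = 1 + (2 ^ Suc r - 1) * w"
      by (simp add: algebra_simps)
    finally show ?case .
  qed simp
  have "(1 + u / 2 ^ r) ^ r \<le> 1 + (2 ^ r - 1) * (u / 2 ^ r)"
    using assms by (intro bound) (auto simp: divide_le_eq intro: order_trans[OF assms(2)])
  also have "\<dots> \<le> 1 + 2 ^ r * (u / 2 ^ r)"
    using assms by (intro add_left_mono mult_right_mono) auto
  finally show ?thesis by simp
qed

lemma pow_le_imp_le:
  fixes x y :: real
  assumes "0 < r" "0 \<le> y" "x ^ r \<le> y ^ r"
  shows "x \<le> y"
  using assms power_le_imp_le_base[of x "r - 1" y] by simp

text \<open>Returns from powers to coordinates at no cost: the ratio \<open>q = x / y\<close> lies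
  in \<open>[0, 1]\<close>, so \<open>q ^ r\<close> is at most \<open>q\<close>.\<close>

lemma le_sub_of_pow_le:
  fixes x y t :: real
  assumes "0 < r" "0 \<le> x" "x \<le> y" "0 < y" "(1 - t) * y ^ r \<le> x ^ r"
  shows "y - x \<le> t * y"
proof -
  define q where "q = x / y"
  have q: "0 \<le> q" "q \<le> 1" using assms by (auto simp: q_def)
  have "1 - t \<le> q ^ r"
    using assms by (simp add: q_def power_divide pos_le_divide_eq)
  also have "q ^ r \<le> q"
    using q assms(1) power_decreasing[of 1 r q] by simp
  finally have "(1 - t) * y \<le> q * y"
    using assms by (intro mult_right_mono) auto
  then show ?thesis using assms by (simp add: q_def algebra_simps)
qed

text \<open>\<open>R\<close> plays the part of the inverse of \<open>P\<close>. Its nonnegativity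
  makes one step monotone, and the signs of \<open>P\<close> off the diagonal give positive
  diagonals of both.\<close>

locale monotone_iteration =
  fixes n r :: nat and P R :: "nat \<Rightarrow> nat \<Rightarrow> real" and L :: tensor and b :: "nat \<Rightarrow> real"
  assumes r_pos: "0 < r"
    and P_off: "i < n \<Longrightarrow> j < n \<Longrightarrow> i \<noteq> j \<Longrightarrow> P i j \<le> 0"
    and R_nonneg: "i < n \<Longrightarrow> j < n \<Longrightarrow> 0 \<le> R i j"
    and RP: "i < n \<Longrightarrow> j < n \<Longrightarrow> (\<Sum>k<n. R i k * P k j) = (if i = j then 1 else 0)"
    and PR: "i < n \<Longrightarrow> j < n \<Longrightarrow> (\<Sum>k<n. P i k * R k j) = (if i = j then 1 else 0)"
    and L_nonneg: "i < n \<Longrightarrow> is \<in> tuples n r \<Longrightarrow> 0 \<le> L (i # is)"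
    and b_nonneg: "i < n \<Longrightarrow> 0 \<le> b i"
begin

abbreviation T :: "(nat \<Rightarrow> real) \<Rightarrow> nat \<Rightarrow> real" where
  "T \<equiv> tensor_form n r L"

definition Pmul :: "(nat \<Rightarrow> real) \<Rightarrow> nat \<Rightarrow> real" where
  "Pmul u i = (\<Sum>j<n. P i j * u j)"

definition Rmul :: "(nat \<Rightarrow> real) \<Rightarrow> nat \<Rightarrow> real" where
  "Rmul u i = (\<Sum>j<n. R i j * u j)"

lemma Rmul_Pmul: "i < n \<Longrightarrow> Rmul (Pmul u) i = u i"
proof -
  assume i: "i < n"
  have "Rmul (Pmul u) i = (\<Sum>k<n. \<Sum>j<n. R i k * P k j * u j)"
    by (simp add: Rmul_def Pmul_def sum_distrib_left mult.assoc)
  also have "\<dots> = (\<Sum>j<n. (\<Sum>k<n. R i k * P k j) * u j)"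
    by (subst sum.swap) (simp add: sum_distrib_right)
  also have "\<dots> = (\<Sum>j<n. (if i = j then 1 else 0) * u j)"
    using i by (intro sum.cong) (auto simp: RP)
  also have "\<dots> = u i"
    using i by (simp add: if_distrib[of "\<lambda>z. z * _"] cong: if_cong)
  finally show ?thesis .
qed

lemma Pmul_Rmul: "i < n \<Longrightarrow> Pmul (Rmul u) i = u i"
proof -
  assume i: "i < n"
  have "Pmul (Rmul u) i = (\<Sum>k<n. \<Sum>j<n. P i k * R k j * u j)"
    by (simp add: Rmul_def Pmul_def sum_distrib_left mult.assoc)
  also have "\<dots> = (\<Sum>j<n. (\<Sum>k<n. P i k * R k j) * u j)"
    by (subst sum.swap) (simp add: sum_distrib_right)
  also have "\<dots> = (\<Sum>j<n. (if i = j then 1 else 0) * u j)"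
    using i by (intro sum.cong) (auto simp: PR)
  also have "\<dots> = u i"
    using i by (simp add: if_distrib[of "\<lambda>z. z * _"] cong: if_cong)
  finally show ?thesis .
qed

lemma Rmul_mono: "(\<And>j. j < n \<Longrightarrow> u j \<le> v j) \<Longrightarrow> i < n \<Longrightarrow> Rmul u i \<le> Rmul v i"
  unfolding Rmul_def by (intro sum_mono mult_left_mono R_nonneg) auto

lemma Rmul_cong: "(\<And>j. j < n \<Longrightarrow> u j = v j) \<Longrightarrow> Rmul u i = Rmul v i"
  unfolding Rmul_def by (intro sum.cong) auto

lemma Rmul_ge_single:
  assumes "\<And>j. j < n \<Longrightarrow> 0 \<le> u j" "i < n" "k < n"
  shows "R i k * u k \<le> Rmul u i"
  unfolding Rmul_def using assms
  by (intro member_le_sum[of k "{..<n}" "\<lambda>k. R i k * u k"]) (auto intro!: mult_nonneg_nonneg R_nonneg)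

lemma Rmul_lin: "Rmul (\<lambda>j. c * u j + d * v j) i = c * Rmul u i + d * Rmul v i"
  unfolding Rmul_def by (simp add: sum_distrib_left sum.distrib algebra_simps)

text \<open>In the diagonal entry of \<open>P R = I\<close> all products other than the diagonal one
  are nonpositive.\<close>

lemma diag_PR: "i < n \<Longrightarrow> 1 \<le> P i i * R i i"
proof -
  assume i: "i < n"
  have "1 = P i i * R i i + (\<Sum>k\<in>{..<n}-{i}. P i k * R k i)"
    using PR[OF i i] i by (simp add: sum.remove[of "{..<n}" i])
  moreover have "(\<Sum>k\<in>{..<n}-{i}. P i k * R k i) \<le> 0"
    using i by (intro sum_nonpos mult_nonpos_nonneg P_off R_nonneg) auto
  ultimately show ?thesis by simp
qed

lemma R_diag_pos: "i < n \<Longrightarrow> 0 < R i i"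
  using diag_PR[of i] R_nonneg[of i i] by (cases "R i i = 0") auto

lemma P_diag_pos: "i < n \<Longrightarrow> 0 < P i i"
  using diag_PR[of i] R_diag_pos[of i] mult_nonpos_nonneg[of "P i i" "R i i"] by (cases "P i i > 0") auto

lemma Rmul_pos: "(\<And>j. j < n \<Longrightarrow> 0 \<le> u j) \<Longrightarrow> i < n \<Longrightarrow> 0 < u i \<Longrightarrow> 0 < Rmul u i"
  using Rmul_ge_single[of u i i] R_diag_pos[of i] mult_pos_pos[of "R i i" "u i"] by (meson less_le_trans)

lemma Rmul_pos_iff:
  assumes "\<And>j. j < n \<Longrightarrow> 0 \<le> u j" "i < n"
  shows "0 < Rmul u i \<longleftrightarrow> (\<exists>j<n. 0 < R i j \<and> 0 < u j)"
proof -
  have nn: "\<And>j. j \<in> {..<n} \<Longrightarrow> 0 \<le> R i j * u j"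
    using assms R_nonneg by simp
  have "0 < Rmul u i \<longleftrightarrow> (\<exists>j<n. R i j * u j \<noteq> 0)"
    using sum_nonneg[of "{..<n}", OF nn] sum_nonneg_eq_0_iff[of "{..<n}", OF _ nn]
    unfolding Rmul_def by (fastforce simp: less_le)
  also have "\<dots> \<longleftrightarrow> (\<exists>j<n. 0 < R i j \<and> 0 < u j)"
    using assms R_nonneg by (metis less_le mult_eq_0_iff)
  finally show ?thesis .
qed

lemma T_mono:
  assumes "\<And>j. j < n \<Longrightarrow> 0 \<le> x j" "\<And>j. j < n \<Longrightarrow> x j \<le> y j" "i < n"
  shows "T x i \<le> T y i"
  unfolding tensor_form_def using assms
  by (intro sum_mono mult_left_mono prod_mono L_nonneg) (auto intro: tuples_nth)

lemma T_nonneg: "(\<And>j. j < n \<Longrightarrow> 0 \<le> x j) \<Longrightarrow> i < n \<Longrightarrow> 0 \<le> T x i"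
  unfolding tensor_form_def
  by (intro sum_nonneg mult_nonneg_nonneg prod_nonneg L_nonneg) (auto intro: tuples_nth)

lemma T_pos_iff:
  assumes "\<And>j. j < n \<Longrightarrow> 0 \<le> x j" "i < n"
  shows "0 < T x i \<longleftrightarrow> (\<exists>is\<in>tuples n r. 0 < L (i # is) \<and> (\<forall>j\<in>set is. 0 < x j))"
proof -
  have nn: "\<And>is. is \<in> tuples n r \<Longrightarrow> 0 \<le> L (i # is) * (\<Prod>k<r. x (is ! k))"
    using assms by (intro mult_nonneg_nonneg prod_nonneg L_nonneg) (auto intro: tuples_nth)
  have pr: "(\<Prod>k<r. x (is ! k)) \<noteq> 0 \<longleftrightarrow> (\<forall>j\<in>set is. 0 < x j)" if "is \<in> tuples n r" for "is"
  proof -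
    have l: "length is = r" and s: "\<And>j. j \<in> set is \<Longrightarrow> 0 \<le> x j"
      using that assms by (auto simp: tuples_def)
    show ?thesis using s by (force simp: prod_zero_iff all_set_conv_all_nth l less_le)
  qed
  have "0 < T x i \<longleftrightarrow> (\<exists>is\<in>tuples n r. L (i # is) * (\<Prod>k<r. x (is ! k)) \<noteq> 0)"
    using sum_nonneg[of "tuples n r", OF nn] sum_nonneg_eq_0_iff[of "tuples n r", OF _ nn]
    unfolding tensor_form_def by (fastforce simp: less_le)
  also have "\<dots> \<longleftrightarrow> (\<exists>is\<in>tuples n r. 0 < L (i # is) \<and> (\<forall>j\<in>set is. 0 < x j))"
    using L_nonneg[OF assms(2)] pr by (metis less_le mult_eq_0_iff)
  finally show ?thesis .
qed

lemma iterate_eq: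
  assumes "\<And>i. i < n \<Longrightarrow> Pmul (\<lambda>j. u j ^ r) i = T x i + b i" "i < n"
  shows "u i ^ r = Rmul (\<lambda>j. T x j + b j) i"
proof -
  have "u i ^ r = Rmul (Pmul (\<lambda>j. u j ^ r)) i"
    by (rule Rmul_Pmul[OF assms(2), symmetric])
  also have "\<dots> = Rmul (\<lambda>j. T x j + b j) i"
    by (rule Rmul_cong[OF assms(1)])
  finally show ?thesis .
qed

lemma supersolution_ge:
  assumes "\<And>i. i < n \<Longrightarrow> T y i + b i \<le> Pmul (\<lambda>j. y j ^ r) i" "i < n"
  shows "Rmul (\<lambda>j. T y j + b j) i \<le> y i ^ r"
proof -
  have "Rmul (\<lambda>j. T y j + b j) i \<le> Rmul (Pmul (\<lambda>j. y j ^ r)) i"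
    by (rule Rmul_mono[OF assms])
  also have "\<dots> = y i ^ r"
    by (rule Rmul_Pmul[OF assms(2)])
  finally show ?thesis .
qed

end

section \<open>Order, limits and zero patterns of the iterates\<close>

locale iteration_sequence = monotone_iteration +
  fixes k0 :: nat and x :: "nat \<Rightarrow> nat \<Rightarrow> real"
  assumes x_nonneg: "k0 \<le> k \<Longrightarrow> i < n \<Longrightarrow> 0 \<le> x k i"
    and x_step: "k0 \<le> k \<Longrightarrow> i < n \<Longrightarrow> Pmul (\<lambda>j. x (Suc k) j ^ r) i = T (x k) i + b i"
begin

lemma x_Suc_pow: "k0 \<le> k \<Longrightarrow> i < n \<Longrightarrow> x (Suc k) i ^ r = Rmul (\<lambda>j. T (x k) j + b j) i"
  by (rule iterate_eq[OF x_step])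

lemma x_le_supersolution:
  assumes "\<And>i. i < n \<Longrightarrow> 0 \<le> y i" "\<And>i. i < n \<Longrightarrow> T y i + b i \<le> Pmul (\<lambda>j. y j ^ r) i"
    and "\<And>i. i < n \<Longrightarrow> x k0 i \<le> y i"
    and "k0 \<le> k" "i < n"
  shows "x k i \<le> y i"
  using assms(4,5)
proof (induction k arbitrary: i rule: dec_induct)
  case base
  then show ?case by (rule assms(3))
next
  case (step k)
  have "x (Suc k) i ^ r \<le> Rmul (\<lambda>j. T y j + b j) i"
    unfolding x_Suc_pow[OF step(1) step(4)]
    by (rule Rmul_mono[OF add_right_mono[OF T_mono] step(4)]) (simp_all add: x_nonneg step)
  also have "\<dots> \<le> y i ^ r"
    by (rule supersolution_ge[OF assms(2) step(4)])
  finally show ?case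
    by (rule pow_le_imp_le[OF r_pos assms(1)[OF step(4)]])
qed

lemma x_mono:
  assumes "\<And>i. i < n \<Longrightarrow> x k0 i \<le> x (Suc k0) i" "k0 \<le> k" "i < n"
  shows "x k i \<le> x (Suc k) i"
  using assms(2,3)
proof (induction k arbitrary: i rule: dec_induct)
  case base
  then show ?case by (rule assms(1))
next
  case (step k)
  have k: "k0 \<le> k" "k0 \<le> Suc k" "k0 \<le> Suc (Suc k)" using step(1) by auto
  have "x (Suc k) i ^ r \<le> x (Suc (Suc k)) i ^ r"
    unfolding x_Suc_pow[OF k(1) step(4)] x_Suc_pow[OF k(2) step(4)]
    by (rule Rmul_mono[OF add_right_mono[OF T_mono] step(4)]) (use x_nonneg[OF k(1)] step(3) in blast)+
  then show ?case
    by (rule pow_le_imp_le[OF r_pos x_nonneg[OF k(3) step(4)]])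
qed

lemma limit_solution:
  assumes "\<And>j. j < n \<Longrightarrow> (\<lambda>k. x k j) \<longlonglongrightarrow> xs j" "i < n"
  shows "Pmul (\<lambda>j. xs j ^ r) i = T xs i + b i"
proof -
  have "(\<lambda>k. Pmul (\<lambda>j. x (Suc (k + k0)) j ^ r) i) \<longlonglongrightarrow> Pmul (\<lambda>j. xs j ^ r) i"
    unfolding Pmul_def
    using LIMSEQ_ignore_initial_segment[OF assms(1), of _ "Suc k0"]
    by (intro tendsto_intros) auto
  moreover have "(\<lambda>k. T (x (k + k0)) i + b i) \<longlonglongrightarrow> T xs i + b i"
    using LIMSEQ_ignore_initial_segment[OF assms(1), of _ k0]
    by (intro tendsto_intros tensor_form_tendsto) auto
  moreover have "Pmul (\<lambda>j. x (Suc (k + k0)) j ^ r) i = T (x (k + k0)) i + b i" for k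
    using assms(2) by (intro x_step) auto
  ultimately show ?thesis
    using LIMSEQ_unique by simp
qed

lemma x_Suc_pos_iff:
  assumes "k0 \<le> k" "i < n"
  shows "0 < x (Suc k) i \<longleftrightarrow> (\<exists>j<n. 0 < R i j \<and>
    (0 < b j \<or> (\<exists>is\<in>tuples n r. 0 < L (j # is) \<and> (\<forall>l\<in>set is. 0 < x k l))))"
proof -
  have x: "\<And>j. j < n \<Longrightarrow> 0 \<le> x k j" using assms x_nonneg by auto
  have T: "\<And>j. j < n \<Longrightarrow> 0 \<le> T (x k) j" using T_nonneg x by blast
  have "0 < x (Suc k) i \<longleftrightarrow> 0 < x (Suc k) i ^ r"
  proof -
    have "0 \<le> x (Suc k) i" using x_nonneg[of "Suc k" i] assms by simp
    then show ?thesis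
      using zero_less_power[of "x (Suc k) i" r] zero_power[OF r_pos, where 'a = real] by (metis less_le)
  qed
  also have "\<dots> \<longleftrightarrow> (\<exists>j<n. 0 < R i j \<and> 0 < T (x k) j + b j)"
    unfolding x_Suc_pow[OF assms] using T b_nonneg assms
    by (intro Rmul_pos_iff add_nonneg_nonneg) auto
  also have "\<dots> \<longleftrightarrow> (\<exists>j<n. 0 < R i j \<and> (0 < b j \<or> 0 < T (x k) j))"
    using T b_nonneg
    by (metis add_nonneg_pos add_pos_nonneg add_0 less_le)
  finally show ?thesis by (simp add: T_pos_iff[OF x] cong: conj_cong)
qed

lemma same_pattern_propagates:
  assumes "\<And>i. i < n \<Longrightarrow> 0 < x k1 i \<longleftrightarrow> 0 < x (Suc k1) i" "k0 \<le> k1" "k1 \<le> k" "i < n"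
  shows "0 < x k i \<longleftrightarrow> 0 < x k1 i"
proof -
  \<comment> \<open>The induction carries two consecutive indices: equality of the patterns at
    \<open>k\<close> and \<open>Suc k\<close> is what \<open>x_Suc_pos_iff\<close> turns into
    equality at the next pair.\<close>
  have "(0 < x k i \<longleftrightarrow> 0 < x k1 i) \<and> (0 < x (Suc k) i \<longleftrightarrow> 0 < x k1 i)"
    using assms(3,4)
  proof (induction k arbitrary: i rule: dec_induct)
    case base
    then show ?case using assms(1) by blast
  next
    case (step k)
    have "0 < x (Suc (Suc k)) i \<longleftrightarrow> 0 < x (Suc k) i"
      using step assms(2) by (subst (1 2) x_Suc_pos_iff) (auto simp: tuples_def subset_iff)
    then show ?case using step by blast
  qed
  then show ?thesis by simp
qed

end

subsection \<open>Contraction towards a positive solution\<close>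

text \<open>The initial deficit \<open>t0\<close> must be strictly below 1: \<open>1 - t0\<close> is
  a uniform lower bound for \<open>1 - t\<close> at all later stages and enters the gain
  constants.\<close>

locale dominated_sequence = iteration_sequence +
  fixes xs :: "nat \<Rightarrow> real" and t0 :: real
  assumes xs_pos: "i < n \<Longrightarrow> 0 < xs i"
    and xs_solution: "i < n \<Longrightarrow> Pmul (\<lambda>j. xs j ^ r) i = T xs i + b i"
    and x_le_xs: "k0 \<le> k \<Longrightarrow> i < n \<Longrightarrow> x k i \<le> xs i"
    and t0: "0 \<le> t0" "t0 < 1"
    and x_start: "i < n \<Longrightarrow> (1 - t0) * xs i ^ r \<le> x k0 i ^ r"
begin

text \<open>The parameter \<open>t\<close> bounds the relative deficit of \<open>x k\<close> from the solution, in powers.\<close>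

definition above :: "nat \<Rightarrow> real \<Rightarrow> bool" where
  "above k t \<longleftrightarrow> k0 \<le> k \<and> 0 \<le> t \<and> t \<le> t0 \<and> (\<forall>i<n. (1 - t) * xs i ^ r \<le> x k i ^ r)"

text \<open>Since \<open>1 - t + d * t = 1 - (1 - d) * t\<close>, coordinate \<open>i\<close> has
  its deficit multiplied by \<open>1 - d\<close> after \<open>q\<close> steps. The premise concerns
  all coordinates and the conclusion only one; \<open>d\<close> and \<open>q\<close> do not depend
  on \<open>k\<close> and \<open>t\<close>, so the statement can be iterated.\<close>

definition contracts :: "nat \<Rightarrow> real \<Rightarrow> nat \<Rightarrow> bool" where
  "contracts q d i \<longleftrightarrow> 0 < d \<and> d < 1 \<and>
     (\<forall>k t. above k t \<longrightarrow> (1 - t + d * t) * xs i ^ r \<le> x (k + q) i ^ r)"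

lemma xs_pow: "i < n \<Longrightarrow> xs i ^ r = Rmul (\<lambda>j. T xs j + b j) i"
  by (rule iterate_eq[OF xs_solution])

lemma aboveD:
  assumes "above k t"
  shows "k0 \<le> k" "0 \<le> t" "t \<le> t0" "t < 1" "i < n \<Longrightarrow> (1 - t) * xs i ^ r \<le> x k i ^ r"
  using assms t0 by (auto simp: above_def)

lemma above_coord:
  assumes "above k t" "i < n"
  shows "root r (1 - t) * xs i \<le> x k i"
proof (rule pow_le_imp_le[OF r_pos x_nonneg[OF aboveD(1)[OF assms(1)] assms(2)]])
  show "(root r (1 - t) * xs i) ^ r \<le> x k i ^ r"
    using aboveD[OF assms(1)] assms(2) r_pos
    by (simp add: power_mult_distrib real_root_pow_pos2)
qed

text \<open>Homogeneity of degree one in the powers: each of the \<open>r\<close> factors loses at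
  most \<open>root r (1 - t)\<close>, and these losses multiply to \<open>1 - t\<close>.\<close>

lemma above_term:
  assumes "above k t" "is \<in> tuples n r"
  shows "(1 - t) * (\<Prod>l<r. xs (is ! l)) \<le> (\<Prod>l<r. x k (is ! l))"
proof -
  have "(1 - t) * (\<Prod>l<r. xs (is ! l)) = (\<Prod>l<r. root r (1 - t) * xs (is ! l))"
    using aboveD[OF assms(1)] r_pos by (simp add: prod.distrib real_root_pow_pos2)
  also have "\<dots> \<le> (\<Prod>l<r. x k (is ! l))"
    using assms aboveD[OF assms(1)]
    by (intro prod_mono conjI above_coord[OF assms(1)])
      (auto intro!: tuples_nth mult_nonneg_nonneg less_imp_le[OF xs_pos])
  finally show ?thesis .
qed

lemma above_T:
  assumes "above k t" "i < n"
  shows "(1 - t) * T xs i \<le> T (x k) i"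
proof -
  have "(1 - t) * T xs i = (\<Sum>is\<in>tuples n r. L (i # is) * ((1 - t) * (\<Prod>l<r. xs (is ! l))))"
    unfolding tensor_form_def sum_distrib_left by (simp add: mult.left_commute)
  also have "\<dots> \<le> T (x k) i"
    unfolding tensor_form_def using assms
    by (intro sum_mono mult_left_mono above_term L_nonneg)
  finally show ?thesis .
qed

text \<open>The excess over \<open>(1 - t)\<close> times the solution is \<open>R\<close> applied to
  a nonnegative vector. Hence every single contribution, from \<open>b\<close> or from one term of
  the tensor, is already a lower bound for it.\<close>

lemma above_step_diff:
  assumes "above k t" "i < n"
  shows "Rmul (\<lambda>j. T (x k) j - (1 - t) * T xs j + t * b j) i = x (Suc k) i ^ r - (1 - t) * xs i ^ r"
proof -
  have "Rmul (\<lambda>j. T (x k) j - (1 - t) * T xs j + t * b j) i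
    = Rmul (\<lambda>j. 1 * (T (x k) j + b j) + (- (1 - t)) * (T xs j + b j)) i"
    by (rule Rmul_cong) (simp add: algebra_simps)
  also have "\<dots> = x (Suc k) i ^ r - (1 - t) * xs i ^ r"
    unfolding Rmul_lin xs_pow[OF assms(2)] x_Suc_pow[OF aboveD(1)[OF assms(1)] assms(2)]
    by (simp add: left_diff_distrib)
  finally show ?thesis .
qed

lemma above_step_diff_nonneg:
  assumes "above k t" "j < n"
  shows "0 \<le> T (x k) j - (1 - t) * T xs j + t * b j"
  using above_T[OF assms] b_nonneg[OF assms(2)] aboveD[OF assms(1)] by simp

lemma above_Suc:
  assumes "above k t"
  shows "above (Suc k) t"
proof -
  have "(1 - t) * xs i ^ r \<le> x (Suc k) i ^ r" if i: "i < n" for i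
  proof -
    have "0 \<le> Rmul (\<lambda>j. T (x k) j - (1 - t) * T xs j + t * b j) i"
      unfolding Rmul_def
      by (intro sum_nonneg mult_nonneg_nonneg above_step_diff_nonneg[OF assms] R_nonneg i) auto
    then show ?thesis using above_step_diff[OF assms i] by simp
  qed
  then show ?thesis using assms by (simp add: above_def)
qed

lemma above_add: "above k t \<Longrightarrow> above (k + q) t"
  by (induction q) (auto intro: above_Suc)

lemma contracts_weaken:
  assumes "contracts q d i" "0 < d'" "d' \<le> d" "i < n"
  shows "contracts q d' i"
  unfolding contracts_def
proof (intro conjI allI impI)
  fix k t assume *: "above k t"
  have "(1 - t + d' * t) * xs i ^ r \<le> (1 - t + d * t) * xs i ^ r"
    using assms(3) aboveD[OF *] xs_pos[OF assms(4)]
    by (intro mult_right_mono add_left_mono) auto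
  also have "\<dots> \<le> x (k + q) i ^ r"
    using assms(1) * by (simp add: contracts_def)
  finally show "(1 - t + d' * t) * xs i ^ r \<le> x (k + q) i ^ r" .
qed (use assms in \<open>auto simp: contracts_def\<close>)

text \<open>The additional steps are placed before the \<open>q\<close> contracting ones: they
  preserve \<open>above\<close> with the same \<open>t\<close>, and contraction holds from any
  starting index.\<close>

lemma contracts_later: "contracts q d i \<Longrightarrow> q \<le> q' \<Longrightarrow> contracts q' d i"
proof -
  assume c: "contracts q d i" and q: "q \<le> q'"
  have "(1 - t + d * t) * xs i ^ r \<le> x (k + q') i ^ r" if "above k t" for k t
  proof -
    have "above (k + (q' - q)) t" using that by (rule above_add)
    then have "(1 - t + d * t) * xs i ^ r \<le> x (k + (q' - q) + q) i ^ r"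
      using c by (simp add: contracts_def)
    then show ?thesis using q by simp
  qed
  then show ?thesis using c by (simp add: contracts_def)
qed

lemma contractsI_gain:
  assumes "i < n" "0 < g"
    and gain: "\<And>k t. above k t \<Longrightarrow> t * g \<le> x (Suc (k + q)) i ^ r - (1 - t) * xs i ^ r"
  shows "\<exists>d. contracts (Suc q) d i"
proof -
  \<comment> \<open>The quotient makes the absolute gain \<open>t * g\<close> relative to the
    solution; the bound 1/2 keeps \<open>d\<close> below 1.\<close>
  define d where "d = min (1 / 2) (g / xs i ^ r)"
  have p: "0 < xs i ^ r" using xs_pos[OF assms(1)] by simp
  have d: "0 < d" "d < 1" "d * xs i ^ r \<le> g"
    using p assms(2) by (auto simp: d_def min_def pos_le_divide_eq field_simps)
  have "(1 - t + d * t) * xs i ^ r \<le> x (k + Suc q) i ^ r" if a: "above k t" for k t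
  proof -
    have "t * (d * xs i ^ r) \<le> t * g"
      using aboveD[OF a] d by (intro mult_left_mono) auto
    then show ?thesis using gain[OF a] by (simp add: algebra_simps)
  qed
  then have "contracts (Suc q) d i" using d by (simp add: contracts_def)
  then show ?thesis ..
qed

lemma contracts_source:
  assumes "i < n" "0 < Rmul b i"
  shows "\<exists>d. contracts (Suc 0) d i"
proof (rule contractsI_gain[OF assms])
  fix k t assume a: "above k t"
  have "t * Rmul b i = Rmul (\<lambda>j. t * b j) i"
    by (simp add: Rmul_def sum_distrib_left mult.left_commute)
  also have "\<dots> \<le> Rmul (\<lambda>j. T (x k) j - (1 - t) * T xs j + t * b j) i"
    using above_T[OF a] by (intro Rmul_mono assms(1)) simp
  also have "\<dots> = x (Suc k) i ^ r - (1 - t) * xs i ^ r"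
    by (rule above_step_diff[OF a assms(1)])
  finally show "t * Rmul b i \<le> x (Suc (k + 0)) i ^ r - (1 - t) * xs i ^ r" by simp
qed

text \<open>All factors carry \<open>root r (1 - t)\<close>; factor \<open>j\<close> has in addition
  \<open>1 + d * t\<close> in its power, hence \<open>1 + d * t / 2 ^ r\<close> itself by
  \<open>one_plus_pow_le\<close>. The monomial thus exceeds \<open>1 - t\<close> by the proportion
  \<open>(1 - t) * d * t / 2 ^ r\<close>, and \<open>1 - t0 \<le> 1 - t\<close> makes this a uniform
  multiple of \<open>t\<close>.\<close>

lemma term_gain:
  assumes a: "above k t" and idx: "is \<in> tuples n r" and j: "j \<in> set is"
    and d: "0 < d" "d < 1" and xj: "(1 - t + d * t) * xs j ^ r \<le> x k j ^ r"
  shows "(1 - t + t * ((1 - t0) * d / 2 ^ r)) * (\<Prod>l<r. xs (is ! l)) \<le> (\<Prod>l<r. x k (is ! l))"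
proof -
  note t = aboveD[OF a]
  define s u where "s = root r (1 - t)" and "u = d * t"
  have s: "0 < s" "s ^ r = 1 - t"
    using t r_pos by (auto simp: s_def real_root_pow_pos2)
  have u: "0 \<le> u" "u \<le> 1"
    using t d mult_mono[of d 1 t 1] by (auto simp: u_def)
  have jn: "j < n" using idx j by (rule tuples_mem)
  have "(s * (1 + u / 2 ^ r) * xs j) ^ r \<le> x k j ^ r"
  proof -
    have "(s * (1 + u / 2 ^ r) * xs j) ^ r = ((1 - t) * (1 + u / 2 ^ r) ^ r) * xs j ^ r"
      by (simp add: power_mult_distrib s)
    also have "\<dots> \<le> ((1 - t) * (1 + u)) * xs j ^ r"
      using t u xs_pos[OF jn] by (intro mult_right_mono mult_left_mono one_plus_pow_le) auto
    also have "\<dots> \<le> (1 - t + d * t) * xs j ^ r"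
      using t d xs_pos[OF jn] by (intro mult_right_mono) (auto simp: u_def algebra_simps)
    finally show ?thesis using xj by simp
  qed
  then have xj': "s * (1 + u / 2 ^ r) * xs j \<le> x k j"
    by (rule pow_le_imp_le[OF r_pos x_nonneg[OF t(1) jn]])
  \<comment> \<open>Only one occurrence of \<open>j\<close> is given the extra factor; further
    occurrences are estimated like the other indices.\<close>
  obtain p where p: "p < r" "is ! p = j"
    using idx j by (auto simp: tuples_def in_set_conv_nth)
  have "(1 - t + t * ((1 - t0) * d / 2 ^ r)) * (\<Prod>l<r. xs (is ! l))
      \<le> ((1 + u / 2 ^ r) * s ^ r) * (\<Prod>l<r. xs (is ! l))"
  proof (rule mult_right_mono)
    have "t * ((1 - t0) * d / 2 ^ r) \<le> (1 - t) * (u / 2 ^ r)"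
      using t d mult_right_mono[of "1 - t0" "1 - t" "u / 2 ^ r"] u by (simp add: u_def mult.commute mult.left_commute)
    then show "1 - t + t * ((1 - t0) * d / 2 ^ r) \<le> (1 + u / 2 ^ r) * s ^ r"
      by (simp add: s algebra_simps)
  qed (use idx in \<open>auto intro!: prod_nonneg less_imp_le[OF xs_pos] tuples_nth\<close>)
  also have "\<dots> = (\<Prod>l<r. (if l = p then 1 + u / 2 ^ r else 1) * (s * xs (is ! l)))"
    using p(1) by (simp add: prod.distrib prod.delta)
  also have "\<dots> \<le> (\<Prod>l<r. x k (is ! l))"
  proof (rule prod_mono, rule conjI)
    fix l assume l: "l \<in> {..<r}"
    then have ln: "is ! l < n" using idx by (auto intro: tuples_nth)
    show "0 \<le> (if l = p then 1 + u / 2 ^ r else 1) * (s * xs (is ! l))"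
      using u s xs_pos[OF ln] by auto
    show "(if l = p then 1 + u / 2 ^ r else 1) * (s * xs (is ! l)) \<le> x k (is ! l)"
      using xj' above_coord[OF a ln] p by (simp add: s_def mult_ac)
  qed
  finally show ?thesis .
qed

lemma contracts_propagate:
  assumes "contracts q d j" "j \<in> set is" "is \<in> tuples n r" "0 < L (l # is)" "0 < R i l"
    and "i < n" "l < n"
  shows "\<exists>d'. contracts (Suc q) d' i"
proof -
  define W where "W = L (l # is) * (\<Prod>l<r. xs (is ! l))"
  define g where "g = R i l * ((1 - t0) * d / 2 ^ r * W)"
  have d: "0 < d" "d < 1" using assms(1) by (auto simp: contracts_def)
  have W: "0 < W"
    unfolding W_def using assms(3,4) by (intro mult_pos_pos prod_pos) (auto intro: xs_pos tuples_nth)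
  have g: "0 < g"
    unfolding g_def using W d t0 assms by simp
  show ?thesis
  proof (rule contractsI_gain[OF assms(6) g])
    fix k t assume a0: "above k t"
    define k' where "k' = k + q"
    have a: "above k' t" using a0 unfolding k'_def by (rule above_add)
    have xj: "(1 - t + d * t) * xs j ^ r \<le> x k' j ^ r"
      using assms(1) a0 by (simp add: contracts_def k'_def)
    define f where "f js = L (l # js) * ((\<Prod>p<r. x k' (js ! p)) - (1 - t) * (\<Prod>p<r. xs (js ! p)))" for js
    have f_nonneg: "0 \<le> f js" if "js \<in> tuples n r" for js
      unfolding f_def using above_term[OF a that] L_nonneg[OF assms(7) that] by simp
    have "t * ((1 - t0) * d / 2 ^ r * W) = L (l # is) * (t * ((1 - t0) * d / 2 ^ r) * (\<Prod>l<r. xs (is ! l)))"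
      by (simp add: W_def)
    also have "\<dots> \<le> f is"
      unfolding f_def using term_gain[OF a assms(3,2) d xj] assms(4)
      by (intro mult_left_mono) (auto simp: distrib_right)
    also have "\<dots> \<le> sum f (tuples n r)"
      by (rule member_le_sum) (use assms f_nonneg in auto)
    also have "\<dots> = T (x k') l - (1 - t) * T xs l"
      by (simp add: f_def tensor_form_def right_diff_distrib sum_subtractf sum_distrib_left mult.left_commute)
    also have "\<dots> \<le> T (x k') l - (1 - t) * T xs l + t * b l"
      using aboveD[OF a] b_nonneg[OF assms(7)] by simp
    finally have "R i l * (t * ((1 - t0) * d / 2 ^ r * W)) \<le> R i l * (T (x k') l - (1 - t) * T xs l + t * b l)"
      using assms(5) by (intro mult_left_mono) auto
    then have "t * g \<le> R i l * (T (x k') l - (1 - t) * T xs l + t * b l)"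
      by (simp add: g_def mult.left_commute)
    also have "\<dots> \<le> Rmul (\<lambda>j. T (x k') j - (1 - t) * T xs j + t * b j) i"
      by (rule Rmul_ge_single[OF above_step_diff_nonneg[OF a] assms(6,7)])
    also have "\<dots> = x (Suc k') i ^ r - (1 - t) * xs i ^ r"
      by (rule above_step_diff[OF a assms(6)])
    finally show "t * g \<le> x (Suc (k + q)) i ^ r - (1 - t) * xs i ^ r"
      by (simp add: k'_def)
  qed
qed

text \<open>With a common number of steps \<open>q\<close> and a common proportion \<open>d\<close>
  for the finitely many coordinates, the overall deficit shrinks by \<open>1 - d\<close> in each
  block of \<open>q\<close> steps; the rate per step is the \<open>q\<close>-th root.\<close>

lemma geometric_bound_of_contracts:
  assumes "\<And>i. i < n \<Longrightarrow> \<exists>q d. contracts q d i"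
  shows "\<exists>C \<rho>. 0 < C \<and> 0 < \<rho> \<and> \<rho> < 1 \<and> (\<forall>k\<ge>k0. \<forall>i<n. \<bar>x k i - xs i\<bar> \<le> C * \<rho> ^ k)"
proof -
  obtain qf df where qd: "\<And>i. i < n \<Longrightarrow> contracts (qf i) (df i) i"
    using assms by metis
  \<comment> \<open>The sum dominates every \<open>qf i\<close>, and \<open>Suc\<close> makes
    \<open>q\<close> positive, as the root and the division into blocks require.\<close>
  define q where "q = Suc (\<Sum>i<n. qf i)"
  define d where "d = Min (insert (1 / 2) (df ` {..<n}))"
  have d: "0 < d" "d < 1"
    using qd by (auto simp: d_def contracts_def Min_less_iff)
  have c: "contracts q d i" if i: "i < n" for i
  proof (rule contracts_later[of "qf i"])
    show "contracts (qf i) d i"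
      using i d by (intro contracts_weaken[OF qd[OF i]]) (auto simp: d_def)
    show "qf i \<le> q" using i member_le_sum[of i "{..<n}" qf] by (simp add: q_def)
  qed
  have abv: "above (k0 + j * q) ((1 - d) ^ j * t0)" for j
  proof (induction j)
    case 0
    show ?case using t0 x_start by (simp add: above_def)
  next
    case (Suc j)
    let ?t = "(1 - d) ^ j * t0"
    have "above (k0 + j * q + q) ((1 - d) * ?t)"
      unfolding above_def
    proof (intro conjI allI impI)
      show "(1 - d) * ?t \<le> t0"
        using d aboveD[OF Suc] mult_mono[of "1 - d" 1 ?t t0] by simp
      fix i assume i: "i < n"
      show "(1 - (1 - d) * ?t) * xs i ^ r \<le> x (k0 + j * q + q) i ^ r"
      proof -
        have "(1 - ?t + d * ?t) * xs i ^ r \<le> x (k0 + j * q + q) i ^ r"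
          using c[OF i] Suc unfolding contracts_def by blast
        moreover have "1 - ?t + d * ?t = 1 - (1 - d) * ?t"
          by (simp add: left_diff_distrib)
        ultimately show ?thesis by simp
      qed
    qed (use d t0 in auto)
    then show ?case by (simp add: algebra_simps)
  qed
  define \<rho> where "\<rho> = root q (1 - d)"
  have q: "0 < q" by (simp add: q_def)
  have \<rho>: "0 < \<rho>" "\<rho> < 1" "\<rho> ^ q = 1 - d"
    using d q by (auto simp: \<rho>_def real_root_pow_pos2)
  define X where "X = 1 + (\<Sum>i<n. xs i)"
  have X: "xs i \<le> X" if "i < n" for i
    using member_le_sum[of i "{..<n}" xs] that xs_pos by (simp add: X_def less_imp_le)
  have Xpos: "0 < X"
    unfolding X_def using sum_nonneg[of "{..<n}" xs] xs_pos by (simp add: less_imp_le add_pos_nonneg)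
  \<comment> \<open>In the constant, \<open>\<rho> ^ k0\<close> accounts for counting from 0 instead
    of \<open>k0\<close>, and \<open>1 - d = \<rho> ^ q\<close> pays for the incomplete last block,
    which has fewer than \<open>q\<close> steps.\<close>
  have "\<bar>x k i - xs i\<bar> \<le> X / (\<rho> ^ k0 * (1 - d)) * \<rho> ^ k" if k: "k0 \<le> k" and i: "i < n" for k i
  proof -
    define j where "j = (k - k0) div q"
    have dm: "j * q + (k - k0) mod q = k - k0" by (simp add: j_def)
    then have "above (k0 + j * q + (k - k0) mod q) ((1 - d) ^ j * t0)"
      by (intro above_add abv)
    moreover have "k0 + j * q + (k - k0) mod q = k"
      using dm k by linarith
    ultimately have a: "above k ((1 - d) ^ j * t0)"
      by (simp only:)
    have "xs i - x k i \<le> ((1 - d) ^ j * t0) * xs i"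
      by (rule le_sub_of_pow_le[OF r_pos x_nonneg x_le_xs xs_pos aboveD(5)[OF a]]) (use k i in auto)
    also have "\<dots> \<le> (1 - d) ^ j * X"
      using t0 d X[OF i] xs_pos[OF i] mult_mono[of t0 1 "xs i" X] by (simp add: mult.assoc)
    also have "\<dots> \<le> \<rho> ^ (k - k0) / (1 - d) * X"
    proof (rule mult_right_mono)
      have "\<rho> ^ q \<le> \<rho> ^ ((k - k0) mod q)"
        using \<rho> q by (intro power_decreasing) (auto intro: less_imp_le)
      then have "(1 - d) ^ j * (1 - d) \<le> (1 - d) ^ j * \<rho> ^ ((k - k0) mod q)"
        using \<rho> d by (intro mult_left_mono) auto
      also have "\<dots> = \<rho> ^ (q * j + (k - k0) mod q)"
        using \<rho> by (simp add: power_add power_mult)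
      also have "\<dots> = \<rho> ^ (k - k0)"
        using dm by (simp add: mult.commute)
      finally show "(1 - d) ^ j \<le> \<rho> ^ (k - k0) / (1 - d)"
        using d by (simp add: pos_le_divide_eq)
    qed (use Xpos in simp)
    also have "\<dots> = X / (\<rho> ^ k0 * (1 - d)) * \<rho> ^ k"
      using \<rho> k by (simp add: power_diff)
    finally show ?thesis using x_le_xs[OF k i] by simp
  qed
  then show ?thesis using \<rho> d Xpos
    by (intro exI[of _ "X / (\<rho> ^ k0 * (1 - d))"] exI[of _ \<rho>]) auto
qed

text \<open>
  The set of contracting coordinates contains the support of \<open>R b\<close> and is closed under the
  dependencies of one step, so it suffices that no proper subset has these two properties.
\<close>

lemma geometric_bound:
  assumes "\<And>S. S \<subseteq> {..<n} \<Longrightarrow> (\<And>i. i < n \<Longrightarrow> 0 < Rmul b i \<Longrightarrow> i \<in> S) \<Longrightarrow>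
      (\<And>i l is j. i < n \<Longrightarrow> l < n \<Longrightarrow> 0 < R i l \<Longrightarrow> is \<in> tuples n r \<Longrightarrow> 0 < L (l # is) \<Longrightarrow>
         j \<in> set is \<Longrightarrow> j \<in> S \<Longrightarrow> i \<in> S) \<Longrightarrow> S = {..<n}"
  shows "\<exists>C \<rho>. 0 < C \<and> 0 < \<rho> \<and> \<rho> < 1 \<and> (\<forall>k\<ge>k0. \<forall>i<n. \<bar>x k i - xs i\<bar> \<le> C * \<rho> ^ k)"
proof (rule geometric_bound_of_contracts)
  define S where "S = {i. i < n \<and> (\<exists>q d. contracts q d i)}"
  have "S = {..<n}"
  proof (rule assms)
    show "S \<subseteq> {..<n}" by (auto simp: S_def)
    show "i \<in> S" if "i < n" "0 < Rmul b i" for i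
      using contracts_source[OF that] that by (auto simp: S_def)
    show "i \<in> S" if "i < n" "l < n" "0 < R i l" "is \<in> tuples n r" "0 < L (l # is)" "j \<in> set is" "j \<in> S"
      for i l "is" j
    proof -
      obtain q d where "contracts q d j" using \<open>j \<in> S\<close> by (auto simp: S_def)
      then have "\<exists>d'. contracts (Suc q) d' i"
        by (rule contracts_propagate[OF _ that(6,4,5,3,1,2)])
      then show ?thesis using that by (auto simp: S_def)
    qed
  qed
  then show "\<And>i. i < n \<Longrightarrow> \<exists>q d. contracts q d i" by (auto simp: S_def)
qed

end

section \<open>Linear rate from a positive start, and finite termination\<close>

context iteration_sequence
begin

lemma linear_bound:
  assumes xs_pos: "\<And>i. i < n \<Longrightarrow> 0 < xs i"
    and xs_sol: "\<And>i. i < n \<Longrightarrow> Pmul (\<lambda>j. xs j ^ r) i = T xs i + b i"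
    and x_le: "\<And>k i. k0 \<le> k \<Longrightarrow> i < n \<Longrightarrow> x k i \<le> xs i"
    and start: "\<And>i. i < n \<Longrightarrow> 0 < x k0 i"
    and closed: "\<And>S. S \<subseteq> {..<n} \<Longrightarrow> (\<And>i. i < n \<Longrightarrow> 0 < Rmul b i \<Longrightarrow> i \<in> S) \<Longrightarrow>
      (\<And>i l is j. i < n \<Longrightarrow> l < n \<Longrightarrow> 0 < R i l \<Longrightarrow> is \<in> tuples n r \<Longrightarrow> 0 < L (l # is) \<Longrightarrow>
         j \<in> set is \<Longrightarrow> j \<in> S \<Longrightarrow> i \<in> S) \<Longrightarrow> S = {..<n}"
  shows "\<exists>C \<rho>. 0 < C \<and> 0 < \<rho> \<and> \<rho> < 1 \<and> (\<forall>k\<ge>k0. \<forall>i<n. \<bar>x k i - xs i\<bar> \<le> C * \<rho> ^ k)"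
proof -
  \<comment> \<open>The least ratio of the starting powers to those of the solution, so that
    \<open>1 - e\<close> is an admissible initial deficit. Inserting 1 covers \<open>n = 0\<close>
    and bounds \<open>e\<close> by 1.\<close>
  define e where "e = Min (insert 1 ((\<lambda>i. x k0 i ^ r / xs i ^ r) ` {..<n}))"
  have e: "0 < e" "e \<le> 1"
    using start xs_pos by (auto simp: e_def Min_gr_iff)
  have es: "e * xs i ^ r \<le> x k0 i ^ r" if "i < n" for i
  proof -
    have "e \<le> x k0 i ^ r / xs i ^ r"
      unfolding e_def using that by (intro Min_le) auto
    then show ?thesis using xs_pos[OF that] by (simp add: pos_le_divide_eq)
  qed
  interpret dominated_sequence n r P R L b k0 x xs "1 - e"
    using assms e es by unfold_locales auto
  show ?thesis by (rule geometric_bound[OF closed])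
qed

text \<open>Equation \<open>i\<close> involves, apart from its own diagonal term in
  \<open>P\<close>, only coordinates of smaller rank. Once these are exact, \<open>P i i > 0\<close>
  determines coordinate \<open>i\<close>, so one rank settles per step.\<close>

lemma eventually_eq_of_rank:
  assumes rank_P: "\<And>i j. i < n \<Longrightarrow> j < n \<Longrightarrow> j \<noteq> i \<Longrightarrow> P i j \<noteq> 0 \<Longrightarrow> rank j < rank i"
    and rank_L: "\<And>i is j. i < n \<Longrightarrow> is \<in> tuples n r \<Longrightarrow> L (i # is) \<noteq> 0 \<Longrightarrow> j \<in> set is \<Longrightarrow> rank j < rank i"
    and xs_nonneg: "\<And>i. i < n \<Longrightarrow> 0 \<le> xs i"
    and xs_sol: "\<And>i. i < n \<Longrightarrow> Pmul (\<lambda>j. xs j ^ r) i = T xs i + b i"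
    and "i < n" "k0 + rank i < k"
  shows "x k i = xs i"
  using assms(5,6)
proof (induction "rank i" arbitrary: i k rule: less_induct)
  case less
  \<comment> \<open>The \<open>L\<close> part is evaluated at the previous index \<open>k'\<close>
    and the \<open>P\<close> part at \<open>k\<close>; the strict bound on \<open>k\<close> leaves
    room for the earlier of the two in the induction hypothesis.\<close>
  obtain k' where k': "k = Suc k'" "k0 + rank i \<le> k'"
    using less(3) by (cases k) auto
  have Teq: "T (x k') i = T xs i"
    unfolding tensor_form_def
  proof (rule sum.cong[OF refl])
    fix "is" assume idx: "is \<in> tuples n r"
    show "L (i # is) * (\<Prod>l<r. x k' (is ! l)) = L (i # is) * (\<Prod>l<r. xs (is ! l))"
    proof (cases "L (i # is) = 0")
      case False
      have "x k' (is ! l) = xs (is ! l)" if "l < r" for l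
      proof -
        have "is ! l \<in> set is" using idx that by (auto simp: tuples_def)
        then have "rank (is ! l) < rank i" by (rule rank_L[OF less(2) idx False])
        then show ?thesis using less(1)[of "is ! l" k'] k' tuples_nth[OF idx that] by simp
      qed
      then show ?thesis by simp
    qed simp
  qed
  have split: "Pmul u i = P i i * u i + (\<Sum>j\<in>{..<n}-{i}. P i j * u j)" for u
    unfolding Pmul_def using less(2) by (simp add: sum.remove[of "{..<n}" i])
  have "(\<Sum>j\<in>{..<n}-{i}. P i j * x k j ^ r) = (\<Sum>j\<in>{..<n}-{i}. P i j * xs j ^ r)"
  proof (rule sum.cong[OF refl])
    fix j assume j: "j \<in> {..<n}-{i}"
    show "P i j * x k j ^ r = P i j * xs j ^ r"
    proof (cases "P i j = 0")
      case False
      then have "rank j < rank i" using rank_P[OF less(2)] j by auto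
      then show ?thesis using less(1)[of j k] less(3) j by simp
    qed simp
  qed
  moreover have "Pmul (\<lambda>j. x k j ^ r) i = Pmul (\<lambda>j. xs j ^ r) i"
    using x_step[of k' i] k' less(2) xs_sol[OF less(2)] Teq by simp
  ultimately have "P i i * x k i ^ r = P i i * xs i ^ r"
    unfolding split by simp
  then have "x k i ^ r = xs i ^ r"
    using P_diag_pos[OF less(2)] by simp
  then show ?case
    using x_nonneg[of k i] xs_nonneg[OF less(2)] less(2,3) r_pos power_eq_imp_eq_base[of "x k i" r "xs i"] by simp
qed

end

subsection \<open>M-matrices\<close>

text \<open>A minimum principle. If the least ratio \<open>c\<close> of \<open>v\<close> to
  \<open>z\<close> is negative and attained at \<open>k\<close>, then \<open>v - c z\<close> is
  nonnegative and vanishes at \<open>k\<close>, so row \<open>k\<close> of \<open>P\<close> maps it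
  to a nonpositive number; but \<open>P v - c P z\<close> is positive there.\<close>

lemma Z_semipositive_monotone:
  fixes P :: "nat \<Rightarrow> nat \<Rightarrow> real"
  assumes off: "\<And>i j. i < n \<Longrightarrow> j < n \<Longrightarrow> i \<noteq> j \<Longrightarrow> P i j \<le> 0"
    and z: "\<And>i. i < n \<Longrightarrow> 0 < z i" and Pz: "\<And>i. i < n \<Longrightarrow> 0 < (\<Sum>j<n. P i j * z j)"
    and Pv: "\<And>i. i < n \<Longrightarrow> 0 \<le> (\<Sum>j<n. P i j * v j)"
    and "i < n"
  shows "0 \<le> v i"
proof (rule ccontr)
  assume "\<not> 0 \<le> v i"
  define c where "c = Min ((\<lambda>i. v i / z i) ` {..<n})"
  have "c \<in> (\<lambda>i. v i / z i) ` {..<n}"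
    unfolding c_def using assms(5) by (intro Min_in) auto
  then obtain k where k: "k < n" "c = v k / z k" by auto
  have c_le: "c \<le> v j / z j" if "j < n" for j
    unfolding c_def using that by (intro Min_le) auto
  have "c < 0"
    using c_le[OF assms(5)] \<open>\<not> 0 \<le> v i\<close> z[OF assms(5)] divide_neg_pos[of "v i" "z i"] by simp
  have "(\<Sum>j<n. P k j * (v j - c * z j)) \<le> 0"
  proof (rule sum_nonpos)
    fix j assume "j \<in> {..<n}"
    then have j: "j < n" by simp
    show "P k j * (v j - c * z j) \<le> 0"
    proof (cases "j = k")
      case True
      then show ?thesis using k z[OF k(1)] by simp
    next
      case False
      have "c * z j \<le> v j" using c_le[OF j] z[OF j] by (simp add: pos_le_divide_eq)
      then show ?thesis using off[OF k(1) j] False by (intro mult_nonpos_nonneg) auto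
    qed
  qed
  moreover have "(\<Sum>j<n. P k j * (v j - c * z j)) = (\<Sum>j<n. P k j * v j) - c * (\<Sum>j<n. P k j * z j)"
    by (simp add: right_diff_distrib sum_subtractf sum_distrib_left mult.left_commute)
  moreover have "c * (\<Sum>j<n. P k j * z j) < 0"
    using \<open>c < 0\<close> Pz[OF k(1)] by (rule mult_neg_pos)
  ultimately show False using Pv[OF k(1)] by linarith
qed

text \<open>A classical characterization of nonsingular M-matrices. It is preferred to the spectral
  one because the witness \<open>z\<close> can simply be restricted to an index set.\<close>

definition semipositive_Z_mat :: "nat \<Rightarrow> real mat \<Rightarrow> bool" where
  "semipositive_Z_mat n P \<longleftrightarrow> P \<in> carrier_mat n n \<and>
     (\<forall>i<n. \<forall>j<n. i \<noteq> j \<longrightarrow> P $$ (i, j) \<le> 0) \<and>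
     (\<exists>z. (\<forall>i<n. 0 < z i) \<and> (\<forall>i<n. 0 < (\<Sum>j<n. P $$ (i, j) * z j)))"

lemma mult_mat_vec_sum:
  fixes P :: "'a :: comm_semiring_1 mat"
  assumes "P \<in> carrier_mat n k" "v \<in> carrier_vec k" "i < n"
  shows "(P *\<^sub>v v) $ i = (\<Sum>j<k. P $$ (i, j) * v $ j)"
  using assms by (simp add: scalar_prod_def atLeast0LessThan)

lemma mult_mat_sum:
  fixes P :: "'a :: comm_semiring_1 mat"
  assumes "P \<in> carrier_mat n k" "R \<in> carrier_mat k l" "i < n" "j < l"
  shows "(P * R) $$ (i, j) = (\<Sum>h<k. P $$ (i, h) * R $$ (h, j))"
  using assms by (simp add: scalar_prod_def atLeast0LessThan)

text \<open>Everything comes from the minimum principle: applied to a kernel vector and its negative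
  it gives invertibility, applied to the columns of the inverse it gives their
  nonnegativity.\<close>

lemma semipositive_Z_mat_inverse:
  assumes P: "semipositive_Z_mat n P"
  shows "mat_inv P \<in> carrier_mat n n" "P * mat_inv P = 1\<^sub>m n" "mat_inv P * P = 1\<^sub>m n"
    and "i < n \<Longrightarrow> j < n \<Longrightarrow> 0 \<le> mat_inv P $$ (i, j)"
proof -
  have Pc: "P \<in> carrier_mat n n"
    and off: "\<And>i j. i < n \<Longrightarrow> j < n \<Longrightarrow> i \<noteq> j \<Longrightarrow> P $$ (i, j) \<le> 0"
    using P by (auto simp: semipositive_Z_mat_def)
  obtain z where z: "\<And>i. i < n \<Longrightarrow> 0 < z i" "\<And>i. i < n \<Longrightarrow> 0 < (\<Sum>j<n. P $$ (i, j) * z j)"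
    using P by (auto simp: semipositive_Z_mat_def)
  note mono = Z_semipositive_monotone[of n "\<lambda>i j. P $$ (i, j)", OF off z]
  have "det P \<noteq> 0"
  proof
    assume "det P = 0"
    then obtain v where v: "v \<in> carrier_vec n" "v \<noteq> 0\<^sub>v n" "P *\<^sub>v v = 0\<^sub>v n"
      using det_0_iff_vec_prod_zero_field[OF Pc] by auto
    have Pv: "(\<Sum>j<n. P $$ (i, j) * v $ j) = 0" if "i < n" for i
      using mult_mat_vec_sum[OF Pc v(1) that] v(3) that by simp
    have "v $ i = 0" if i: "i < n" for i
    proof (rule antisym)
      show "0 \<le> v $ i" by (rule mono) (use Pv i in auto)
      have "0 \<le> - v $ i" by (rule mono[where v = "\<lambda>j. - v $ j"]) (use Pv i in \<open>auto simp: sum_negf\<close>)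
      then show "v $ i \<le> 0" by simp
    qed
    then show False using v by auto
  qed
  then have "P \<in> Units (ring_mat TYPE(real) n ())"
    by (rule det_non_zero_imp_unit[OF Pc])
  then obtain B where "mat_inverse P = Some B"
    using mat_inverse(1)[OF Pc, of "()"] by (cases "mat_inverse P") auto
  then have R: "mat_inv P \<in> carrier_mat n n" "P * mat_inv P = 1\<^sub>m n" "mat_inv P * P = 1\<^sub>m n"
    using mat_inverse(2)[OF Pc] by (auto simp: mat_inv_def)
  then show "mat_inv P \<in> carrier_mat n n" "P * mat_inv P = 1\<^sub>m n" "mat_inv P * P = 1\<^sub>m n"
    by auto
  assume i: "i < n" and j: "j < n"
  show "0 \<le> mat_inv P $$ (i, j)"
  proof (rule mono[where v = "\<lambda>k. mat_inv P $$ (k, j)"])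
    fix k assume k: "k < n"
    show "0 \<le> (\<Sum>l<n. P $$ (k, l) * mat_inv P $$ (l, j))"
    proof -
      have "(\<Sum>l<n. P $$ (k, l) * mat_inv P $$ (l, j)) = 1\<^sub>m n $$ (k, j)"
        using mult_mat_sum[OF Pc R(1) k j] R(2) by simp
      then show ?thesis using k j by simp
    qed
  qed (use i in auto)
qed

text \<open>The witness is a truncated Neumann series: for \<open>z\<close> the sum of
  \<open>(B/s)^k e\<close> over \<open>k \<le> K\<close>, telescoping gives
  \<open>P z = s (e - (B/s)^(K+1) e)\<close>, which is positive for large \<open>K\<close>.
  Truncation needs decay of the powers only, not convergence of a matrix series.\<close>

lemma nonsingular_M_matrix_semipositive:
  assumes M: "nonsingular_M_matrix P" and P: "P \<in> carrier_mat n n" and n: "0 < n"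
  shows "semipositive_Z_mat n P"
proof -
  obtain s B where B: "B \<in> carrier_mat n n" "0\<^sub>m n n \<le> B"
    and sB: "spectral_radius (map_mat complex_of_real B) < s" and PsB: "P = s \<cdot>\<^sub>m 1\<^sub>m n - B"
    using M P by (auto simp: nonsingular_M_matrix_def)
  have B_nonneg: "0 \<le> B $$ (i, j)" if "i < n" "j < n" for i j
    using B that by (auto simp: less_eq_mat_def)
  let ?B = "map_mat complex_of_real B"
  let ?\<rho> = "spectral_radius ?B"
  have Bc: "?B \<in> carrier_mat n n" using B by simp
  have rho: "0 \<le> ?\<rho>"
    using spectral_radius_mem_max(1)[OF Bc n] by auto
  \<comment> \<open>Any number strictly between the spectral radius and \<open>s\<close> serves:
    \<open>B / t\<close> then has spectral radius below 1, hence bounded powers, and the remaining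
    factor \<open>t / s\<close> yields the decay.\<close>
  define t where "t = (?\<rho> + s) / 2"
  have t: "?\<rho> < t" "t < s" "0 < t" "0 < s"
    using sB rho by (auto simp: t_def)
  define C where "C = complex_of_real (1 / t) \<cdot>\<^sub>m ?B"
  have C: "C \<in> carrier_mat n n" using Bc by (simp add: C_def)
  have "spectral_radius C < 1"
  proof -
    obtain ev where ev: "eigenvalue C ev" "spectral_radius C = norm ev"
      using spectral_radius_mem_max(1)[OF C n] by (auto simp: spectrum_def)
    then obtain v where v: "v \<in> carrier_vec n" "v \<noteq> 0\<^sub>v n" "C *\<^sub>v v = ev \<cdot>\<^sub>v v"
      using C by (auto simp: eigenvalue_def eigenvector_def)
    have "?B *\<^sub>v v = (complex_of_real t * ev) \<cdot>\<^sub>v v"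
    proof -
      have "complex_of_real t \<cdot>\<^sub>v (C *\<^sub>v v) = ?B *\<^sub>v v"
      proof (rule eq_vecI)
        fix i assume "i < dim_vec (?B *\<^sub>v v)"
        then have i: "i < n" using B by simp
        have "(C *\<^sub>v v) $ i = (\<Sum>j<n. complex_of_real (1 / t) * (?B $$ (i, j) * v $ j))"
          unfolding mult_mat_vec_sum[OF C v(1) i] using i B by (simp add: C_def)
        also have "\<dots> = complex_of_real (1 / t) * (?B *\<^sub>v v) $ i"
          by (simp only: sum_distrib_left mult_mat_vec_sum[OF Bc v(1) i])
        finally show "(complex_of_real t \<cdot>\<^sub>v (C *\<^sub>v v)) $ i = (?B *\<^sub>v v) $ i"
          using i C t by simp
      qed (use B C in simp)
      then show ?thesis using v by (simp add: smult_smult_assoc)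
    qed
    then have "eigenvalue ?B (complex_of_real t * ev)"
      using v Bc by (auto simp: eigenvalue_def eigenvector_def)
    then have "norm (complex_of_real t * ev) \<le> ?\<rho>"
      by (intro spectral_radius_mem_max(2)[OF Bc n]) (auto simp: spectrum_def)
    moreover have "norm (complex_of_real t * ev) = t * norm ev"
      using t by (simp add: norm_mult)
    ultimately have "t * norm ev < t * 1" using t by linarith
    then have "norm ev < 1" using t(3) by (simp only: mult_less_cancel_left_pos)
    then show ?thesis using ev by simp
  qed
  then obtain c where c: "\<And>k. norm_bound (C ^\<^sub>m k) c"
    using spectral_radius_jnf_norm_bound_less_1_upper_triangular[OF C] by blast
  \<comment> \<open>This is entry \<open>i\<close> of \<open>(B/s)^k e\<close>, written through the
    powers of the complex matrix \<open>C = B / t\<close>, for which the norm bound \<open>c\<close>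
    is available.\<close>
  define w where "w k i = Re (\<Sum>j<n. (C ^\<^sub>m k) $$ (i, j)) * (t / s) ^ k" for k i
  have Ck: "C ^\<^sub>m k \<in> carrier_mat n n" for k using C by simp
  have w_Suc: "s * w (Suc k) i = (\<Sum>j<n. B $$ (i, j) * w k j)" if i: "i < n" for k i
  proof -
    have Suc: "C ^\<^sub>m Suc k = C * C ^\<^sub>m k"
      using C by (induction k) (simp_all add: assoc_mult_mat[of _ n n _ n _ n])
    have "(\<Sum>j<n. (C ^\<^sub>m Suc k) $$ (i, j)) = (\<Sum>j<n. \<Sum>h<n. C $$ (i, h) * (C ^\<^sub>m k) $$ (h, j))"
      unfolding Suc using mult_mat_sum[OF C Ck i] by simp
    also have "\<dots> = (\<Sum>h<n. C $$ (i, h) * (\<Sum>j<n. (C ^\<^sub>m k) $$ (h, j)))"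
      by (subst sum.swap) (simp add: sum_distrib_left)
    also have "\<dots> = (\<Sum>h<n. complex_of_real (B $$ (i, h) / t) * (\<Sum>j<n. (C ^\<^sub>m k) $$ (h, j)))"
      using B i by (intro sum.cong) (auto simp: C_def)
    finally have "Re (\<Sum>j<n. (C ^\<^sub>m Suc k) $$ (i, j))
      = (\<Sum>h<n. B $$ (i, h) / t * Re (\<Sum>j<n. (C ^\<^sub>m k) $$ (h, j)))"
      by simp
    then have "s * w (Suc k) i = (\<Sum>h<n. B $$ (i, h) / t * Re (\<Sum>j<n. (C ^\<^sub>m k) $$ (h, j))) * (t * (t / s) ^ k)"
      using t by (simp add: w_def)
    also have "\<dots> = (\<Sum>h<n. B $$ (i, h) * w k h)"
      unfolding sum_distrib_right using t by (intro sum.cong) (auto simp: w_def)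
    finally show ?thesis .
  qed
  have w_0: "w 0 i = 1" if "i < n" for i
    using that C by (simp add: w_def if_distrib[of Re] sum.delta)
  have w_nonneg: "0 \<le> w k i" if "i < n" for k i
    using that
  proof (induction k arbitrary: i)
    case (Suc k)
    have "0 \<le> s * w (Suc k) i"
      unfolding w_Suc[OF Suc(2)] using Suc B_nonneg by (intro sum_nonneg mult_nonneg_nonneg) auto
    then show ?case using t by (simp add: zero_le_mult_iff)
  qed (simp add: w_0)
  have w_bound: "w k i \<le> (real n * c) * (t / s) ^ k" if i: "i < n" for k i
  proof -
    have "Re (\<Sum>j<n. (C ^\<^sub>m k) $$ (i, j)) \<le> (\<Sum>j<n. norm ((C ^\<^sub>m k) $$ (i, j)))"
      by (rule order_trans[OF complex_Re_le_cmod norm_sum])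
    also have "\<dots> \<le> (\<Sum>j<n. c)"
      using c[of k] C i by (intro sum_mono) (auto simp: norm_bound_def)
    finally show ?thesis using t by (auto simp: w_def intro!: mult_right_mono)
  qed
  have "(\<lambda>k. (real n * c) * (t / s) ^ Suc k) \<longlonglongrightarrow> (real n * c) * 0"
    using t by (intro tendsto_mult tendsto_const LIMSEQ_Suc LIMSEQ_realpow_zero) auto
  then have "eventually (\<lambda>k. (real n * c) * (t / s) ^ Suc k < 1) sequentially"
    by (rule order_tendstoD(2)) simp
  then obtain K where K: "(real n * c) * (t / s) ^ Suc K < 1"
    by (auto simp: eventually_sequentially)
  define z where "z i = (\<Sum>k\<le>K. w k i)" for i
  have P_entry: "P $$ (i, j) = (if i = j then s else 0) - B $$ (i, j)" if "i < n" "j < n" for i j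
    using that B by (simp add: PsB)
  have "0 < z i" if i: "i < n" for i
  proof -
    have "w 0 i \<le> z i"
      unfolding z_def using w_nonneg[OF i] by (intro member_le_sum) auto
    then show ?thesis using w_0[OF i] by simp
  qed
  moreover have "0 < (\<Sum>j<n. P $$ (i, j) * z j)" if i: "i < n" for i
  proof -
    have "(\<Sum>j<n. P $$ (i, j) * z j) = (\<Sum>j<n. (if i = j then s else 0) * z j) - (\<Sum>j<n. B $$ (i, j) * z j)"
      using P_entry[OF i] by (simp add: left_diff_distrib sum_subtractf)
    also have "(\<Sum>j<n. (if i = j then s else 0) * z j) = s * z i"
      using i by (simp add: if_distrib[of "\<lambda>a. a * _"] cong: if_cong)
    also have "(\<Sum>j<n. B $$ (i, j) * z j) = (\<Sum>k\<le>K. s * w (Suc k) i)"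
      unfolding z_def sum_distrib_left w_Suc[OF i] by (rule sum.swap)
    also have "s * z i - (\<Sum>k\<le>K. s * w (Suc k) i) = s * (\<Sum>k\<le>K. w k i - w (Suc k) i)"
      by (simp add: z_def sum_subtractf sum_distrib_left right_diff_distrib)
    also have "\<dots> = s * (1 - w (Suc K) i)"
      using sum_telescope[of "\<lambda>k. w k i" K] by (simp only: w_0[OF i])
    also have "0 < \<dots>"
    proof -
      have "w (Suc K) i < 1" using w_bound[OF i, of "Suc K"] K by linarith
      then show ?thesis using t by simp
    qed
    finally show ?thesis .
  qed
  ultimately show ?thesis
    using P P_entry B_nonneg unfolding semipositive_Z_mat_def by auto
qed

section \<open>Principal submatrices and subvectors\<close>

lemma bij_betw_pick:
  assumes "finite J"
  shows "bij_betw (pick J) {..<card J} J"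
proof -
  have inj: "inj_on (pick J) {..<card J}"
    by (rule inj_onI) (metis card_pick lessThan_iff)
  moreover have "pick J ` {..<card J} = J"
    using pick_in_set_le inj assms by (intro card_subset_eq) (auto simp: card_image)
  ultimately show ?thesis by (simp add: bij_betw_def)
qed

lemma sum_pick:
  assumes "finite J"
  shows "(\<Sum>i<card J. f (pick J i)) = sum f J"
  using sum.reindex_bij_betw[OF bij_betw_pick[OF assms]] .

lemma pick_less: "J \<subseteq> {..<n} \<Longrightarrow> i < card J \<Longrightarrow> pick J i < n"
  using pick_in_set_le[of i J] by auto

lemma card_index_set: "J \<subseteq> {..<n} \<Longrightarrow> {i. i < n \<and> i \<in> J} = J"
  by auto

lemma submatrix_principal:
  assumes "P \<in> carrier_mat n n" "J \<subseteq> {..<n}"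
  shows "submatrix P J J \<in> carrier_mat (card J) (card J)"
    and "i < card J \<Longrightarrow> j < card J \<Longrightarrow> submatrix P J J $$ (i, j) = P $$ (pick J i, pick J j)"
  using assms by (auto simp: submatrix_def card_index_set)

lemma subvector_index:
  assumes "v \<in> carrier_vec n" "J \<subseteq> {..<n}"
  shows "subvector v J \<in> carrier_vec (card J)"
    and "i < card J \<Longrightarrow> subvector v J $ i = v $ pick J i"
  using assms by (auto simp: subvector_def card_index_set)

text \<open>In a row with index in \<open>J\<close>, the entries in columns outside \<open>J\<close>
  are off-diagonal, hence nonpositive; deleting them can only increase the row sum against
  \<open>z\<close>.\<close>

lemma semipositive_Z_submatrix:
  assumes P: "semipositive_Z_mat n P" and J: "J \<subseteq> {..<n}"
  shows "semipositive_Z_mat (card J) (submatrix P J J)"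
proof -
  have Pc: "P \<in> carrier_mat n n"
    and off: "\<And>i j. i < n \<Longrightarrow> j < n \<Longrightarrow> i \<noteq> j \<Longrightarrow> P $$ (i, j) \<le> 0"
    using P by (auto simp: semipositive_Z_mat_def)
  obtain z where z: "\<And>i. i < n \<Longrightarrow> 0 < z i" "\<And>i. i < n \<Longrightarrow> 0 < (\<Sum>j<n. P $$ (i, j) * z j)"
    using P by (auto simp: semipositive_Z_mat_def)
  note sub = submatrix_principal[OF Pc J]
  have fin: "finite J" using J finite_subset by blast
  have inj: "pick J i = pick J j \<Longrightarrow> i = j" if "i < card J" "j < card J" for i j
    using bij_betw_pick[OF fin] that by (auto simp: bij_betw_def inj_on_def)
  have "0 < (\<Sum>j<card J. submatrix P J J $$ (i, j) * z (pick J j))" if i: "i < card J" for i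
  proof -
    let ?i = "pick J i"
    have iJ: "?i \<in> J" using i by (rule pick_in_set_le)
    have "(\<Sum>j<n. P $$ (?i, j) * z j)
      = (\<Sum>j\<in>J. P $$ (?i, j) * z j) + (\<Sum>j\<in>{..<n} - J. P $$ (?i, j) * z j)"
      by (subst add.commute, rule sum.subset_diff[OF J]) simp
    moreover have "(\<Sum>j\<in>{..<n} - J. P $$ (?i, j) * z j) \<le> 0"
      using iJ J off z(1) by (intro sum_nonpos mult_nonpos_nonneg) (auto intro: less_imp_le)
    moreover have "0 < (\<Sum>j<n. P $$ (?i, j) * z j)" using z(2) iJ J by auto
    ultimately have "0 < (\<Sum>j\<in>J. P $$ (?i, j) * z j)" by linarith
    also have "\<dots> = (\<Sum>j<card J. P $$ (?i, pick J j) * z (pick J j))"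
      by (rule sum_pick[OF fin, symmetric])
    also have "\<dots> = (\<Sum>j<card J. submatrix P J J $$ (i, j) * z (pick J j))"
      using sub(2)[OF i] by (intro sum.cong) auto
    finally show ?thesis .
  qed
  moreover have "submatrix P J J $$ (i, j) \<le> 0" if "i < card J" "j < card J" "i \<noteq> j" for i j
    using that sub(2) off inj pick_less[OF J] by metis
  ultimately show ?thesis
    unfolding semipositive_Z_mat_def using sub(1) z(1) pick_less[OF J]
    by (intro conjI exI[of _ "\<lambda>i. z (pick J i)"]) auto
qed

lemma semipositive_monotone_iteration:
  assumes P: "semipositive_Z_mat n P" and "0 < r"
    and "\<And>i is. i < n \<Longrightarrow> is \<in> tuples n r \<Longrightarrow> 0 \<le> L (i # is)"
    and "\<And>i. i < n \<Longrightarrow> 0 \<le> b i"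
  shows "monotone_iteration n r (\<lambda>i j. P $$ (i, j)) (\<lambda>i j. mat_inv P $$ (i, j)) L b"
proof -
  have Pc: "P \<in> carrier_mat n n"
    using P by (simp add: semipositive_Z_mat_def)
  note inv = semipositive_Z_mat_inverse[OF P]
  show ?thesis
  proof
    fix i j assume ij: "i < n" "j < n"
    show "i \<noteq> j \<Longrightarrow> P $$ (i, j) \<le> 0" using P ij by (simp add: semipositive_Z_mat_def)
    show "0 \<le> mat_inv P $$ (i, j)" by (rule inv(4)[OF ij])
    show "(\<Sum>k<n. mat_inv P $$ (i, k) * P $$ (k, j)) = (if i = j then 1 else 0)"
      using mult_mat_sum[OF inv(1) Pc ij] inv(3) ij by simp
    show "(\<Sum>k<n. P $$ (i, k) * mat_inv P $$ (k, j)) = (if i = j then 1 else 0)"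
      using mult_mat_sum[OF Pc inv(1) ij] inv(2) ij by simp
  qed (use assms in auto)
qed

subsection \<open>Criteria for linear convergence\<close>

lemma sum_neg_of:
  fixes f :: "'a \<Rightarrow> real"
  assumes "finite S" "j \<in> S" "f j < 0" "\<And>k. k \<in> S \<Longrightarrow> f k \<le> 0"
  shows "sum f S < 0"
  using sum_pos2[of S j "\<lambda>k. - f k"] assms by (simp add: sum_negf)

text \<open>The level-1 splitting and \<open>M = P - Q\<close> merged into one entrywise relation,
  with \<open>Q\<close> absorbed into \<open>L\<close>. In this form it is inherited by
  subtensors.\<close>

locale split_sequence = iteration_sequence n r P R L b k0 x
  for n r P R L b k0 x +
  fixes A :: tensor
  assumes A_replicate: "i < n \<Longrightarrow> j < n \<Longrightarrow> A (i # replicate r j) = P i j - L (i # replicate r j)"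
    and A_other: "i < n \<Longrightarrow> is \<in> tuples n r \<Longrightarrow> (\<And>j. is \<noteq> replicate r j) \<Longrightarrow> A (i # is) = - L (i # is)"
begin

lemma A_off:
  assumes "i < n" "is \<in> tuples n r" "is \<noteq> replicate r i"
  shows "A (i # is) \<le> 0"
proof (cases "\<exists>j. is = replicate r j")
  case True
  then obtain j where j: "is = replicate r j" by blast
  then have "j < n" using assms(2) r_pos by (simp add: tuples_def)
  moreover have "i \<noteq> j" using j assms(3) by auto
  ultimately show ?thesis
    using A_replicate[of i j] P_off[of i j] L_nonneg[OF assms(1,2)] assms(1) j by simp
next
  case False
  then show ?thesis using A_other[OF assms(1,2)] L_nonneg[OF assms(1,2)] by simp
qed

text \<open>The coefficients of \<open>A + L\<close> vanish except on constant tuples, where they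
  are the entries of \<open>P\<close>. Thus solutions of the tensor equation are exactly the fixed
  points of the iteration.\<close>

lemma splitting:
  assumes i: "i < n"
  shows "Pmul (\<lambda>j. y j ^ r) i = tensor_form n r A y i + T y i"
proof -
  let ?g = "\<lambda>is. A (i # is) + L (i # is)"
  let ?D = "replicate r ` {..<n}"
  have D: "?D \<subseteq> tuples n r" by (auto simp: tuples_def)
  have inj: "inj_on (replicate r) {..<n}"
    using r_pos by (auto simp: inj_on_def replicate_eq_replicate)
  have "tensor_form n r A y i + T y i = (\<Sum>is\<in>tuples n r. ?g is * (\<Prod>k<r. y (is ! k)))"
    by (simp add: tensor_form_def sum.distrib distrib_right)
  also have "\<dots> = (\<Sum>is\<in>?D. ?g is * (\<Prod>k<r. y (is ! k)))"
  proof (rule sum.mono_neutral_right[OF finite_tuples D], rule ballI)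
    fix js assume js: "js \<in> tuples n r - ?D"
    have "js \<noteq> replicate r j" for j
      using js r_pos by (force simp: tuples_def)
    then have "A (i # js) = - L (i # js)" using js by (intro A_other i) auto
    then show "?g js * (\<Prod>k<r. y (js ! k)) = 0" by simp
  qed
  also have "\<dots> = (\<Sum>j<n. ?g (replicate r j) * (\<Prod>k<r. y (replicate r j ! k)))"
    by (simp add: sum.reindex[OF inj])
  also have "\<dots> = Pmul (\<lambda>j. y j ^ r) i"
    unfolding Pmul_def using i by (intro sum.cong) (auto simp: A_replicate)
  finally show ?thesis by simp
qed

text \<open>Positivity of \<open>x k0\<close> is included because it makes the initial relative
  deficit smaller than 1.\<close>

definition dominating :: "(nat \<Rightarrow> real) \<Rightarrow> bool" where
  "dominating xs \<longleftrightarrow> (\<forall>i<n. 0 < xs i \<and> tensor_form n r A xs i = b i \<and> 0 < x k0 i) \<and>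
     (\<forall>k\<ge>k0. \<forall>i<n. x k i \<le> xs i)"

definition geometric :: "(nat \<Rightarrow> real) \<Rightarrow> bool" where
  "geometric xs \<longleftrightarrow> (\<exists>C \<rho>. 0 < C \<and> 0 < \<rho> \<and> \<rho> < 1 \<and> (\<forall>k\<ge>k0. \<forall>i<n. \<bar>x k i - xs i\<bar> \<le> C * \<rho> ^ k))"

lemma geometricI:
  assumes "dominating xs"
    and "\<And>S. S \<subseteq> {..<n} \<Longrightarrow> (\<And>i. i < n \<Longrightarrow> 0 < Rmul b i \<Longrightarrow> i \<in> S) \<Longrightarrow>
      (\<And>i l is j. i < n \<Longrightarrow> l < n \<Longrightarrow> 0 < R i l \<Longrightarrow> is \<in> tuples n r \<Longrightarrow> 0 < L (l # is) \<Longrightarrow>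
         j \<in> set is \<Longrightarrow> j \<in> S \<Longrightarrow> i \<in> S) \<Longrightarrow> S = {..<n}"
  shows "geometric xs"
  unfolding geometric_def
  by (rule linear_bound[OF _ _ _ _ assms(2)])
    (use assms(1) splitting in \<open>auto simp: dominating_def\<close>)

lemma geometric_of_positive_source:
  assumes "dominating xs" "\<And>i. i < n \<Longrightarrow> 0 < Rmul b i"
  shows "geometric xs"
  by (rule geometricI[OF assms(1)]) (use assms(2) in auto)

lemma Rmul_b_nonneg: "i < n \<Longrightarrow> 0 \<le> Rmul b i"
  unfolding Rmul_def by (intro sum_nonneg mult_nonneg_nonneg R_nonneg b_nonneg) auto

text \<open>Irreducibility is applied to the complement of the closed set \<open>S\<close>. As
  \<open>j0\<close> lies in \<open>S\<close>, a nonempty complement is a proper subset; a dependency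
  leading from it into \<open>S\<close> contradicts closedness.\<close>

lemma geometric_of_irreducible:
  assumes dom: "dominating xs" and b: "j0 < n" "0 < b j0"
    and irr: "\<And>S. S \<noteq> {} \<Longrightarrow> S \<subset> {..<n} \<Longrightarrow> \<exists>i\<in>S. \<exists>j\<in>{..<n} - S. \<exists>l<n. R i l \<noteq> 0 \<and>
      (\<exists>is\<in>tuples n r. j \<in> set is \<and> L (l # is) \<noteq> 0)"
  shows "geometric xs"
proof (rule geometricI[OF dom])
  fix S assume S: "S \<subseteq> {..<n}" and src: "\<And>i. i < n \<Longrightarrow> 0 < Rmul b i \<Longrightarrow> i \<in> S"
    and cl: "\<And>i l is j. i < n \<Longrightarrow> l < n \<Longrightarrow> 0 < R i l \<Longrightarrow> is \<in> tuples n r \<Longrightarrow> 0 < L (l # is) \<Longrightarrow>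
         j \<in> set is \<Longrightarrow> j \<in> S \<Longrightarrow> i \<in> S"
  show "S = {..<n}"
  proof (rule ccontr)
    assume "S \<noteq> {..<n}"
    moreover have "j0 \<in> S" by (rule src[OF b(1) Rmul_pos[of b, OF b_nonneg b]])
    ultimately have "{..<n} - S \<noteq> {}" "{..<n} - S \<subset> {..<n}" using S by auto
    from irr[OF this] obtain i j l js where *: "i \<in> {..<n} - S" "j \<in> {..<n} - ({..<n} - S)" "l < n"
      "R i l \<noteq> 0" "js \<in> tuples n r" "j \<in> set js" "L (l # js) \<noteq> 0"
      by blast
    then have "0 < R i l" "0 < L (l # js)"
      using R_nonneg[of i l] L_nonneg[of l js] by auto
    then have "i \<in> S" using * by (intro cl[of i l js j]) auto
    then show False using * by auto
  qed
qed

text \<open>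
  A nonzero element of \<open>A\<close> in the positions \<open>(i, j, \<dots>, j)\<close> comes from \<open>L\<close> or from \<open>P\<close>; in the
  latter case \<open>i\<close> already belongs to the support of \<open>R b\<close>.
\<close>

lemma geometric_of_adjacent_source:
  assumes dom: "dominating xs"
    and adj: "\<And>i. i < n \<Longrightarrow> b i = 0 \<Longrightarrow> \<exists>is\<in>tuples n r. (\<exists>j\<in>set is. b j \<noteq> 0) \<and> A (i # is) \<noteq> 0"
  shows "geometric xs"
proof (rule geometricI[OF dom])
  fix S assume S: "S \<subseteq> {..<n}" and src: "\<And>i. i < n \<Longrightarrow> 0 < Rmul b i \<Longrightarrow> i \<in> S"
    and cl: "\<And>i l is j. i < n \<Longrightarrow> l < n \<Longrightarrow> 0 < R i l \<Longrightarrow> is \<in> tuples n r \<Longrightarrow> 0 < L (l # is) \<Longrightarrow>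
         j \<in> set is \<Longrightarrow> j \<in> S \<Longrightarrow> i \<in> S"
  have pos: "j \<in> S \<and> 0 < Rmul b j" if "j < n" "b j \<noteq> 0" for j
    using src Rmul_pos[of b, OF b_nonneg that(1)] b_nonneg[OF that(1)] that by force
  have "i \<in> S" if i: "i < n" for i
  proof (cases "b i = 0")
    case False
    then show ?thesis using pos i by blast
  next
    case True
    then obtain js j where js: "js \<in> tuples n r" "j \<in> set js" "b j \<noteq> 0" "A (i # js) \<noteq> 0"
      using adj[OF i] by blast
    then have j: "j < n" "j \<noteq> i" using tuples_mem True by auto
    show ?thesis
    proof (cases "0 < L (i # js)")
      case True
      then show ?thesis
        using cl[OF i i R_diag_pos[OF i] js(1) True js(2)] pos j js by blast
    next
      case False
      then have L0: "L (i # js) = 0" using L_nonneg[OF i js(1)] by simp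
      then have "\<exists>l. js = replicate r l" using A_other[OF i js(1)] js(4) by auto
      then have "js = replicate r j" using js(2) by auto
      then have "P i j \<noteq> 0" using A_replicate[OF i j(1)] js(4) L0 by simp
      then have Pij: "P i j < 0" using P_off[OF i j(1)] j(2) by fastforce
      \<comment> \<open>Row \<open>i\<close> of \<open>P (R b) = b\<close> has right side 0, while
        the entry \<open>P i j < 0\<close> meets a positive coordinate of \<open>R b\<close>; only a
        positive diagonal term can balance it.\<close>
      have "Pmul (Rmul b) i = b i" by (rule Pmul_Rmul[OF i])
      moreover have "Pmul (Rmul b) i = P i i * Rmul b i + (\<Sum>k\<in>{..<n}-{i}. P i k * Rmul b k)"
        unfolding Pmul_def using i by (simp add: sum.remove[of "{..<n}" i])
      moreover have "(\<Sum>k\<in>{..<n}-{i}. P i k * Rmul b k) < 0"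
      proof (rule sum_neg_of)
        show "P i k * Rmul b k \<le> 0" if "k \<in> {..<n}-{i}" for k
          using that P_off[of i k] i Rmul_b_nonneg[of k] by (intro mult_nonpos_nonneg) auto
        show "P i j * Rmul b j < 0"
          using Pij pos[OF j(1) js(3)] by (intro mult_neg_pos) auto
      qed (use j in auto)
      ultimately have "0 < P i i * Rmul b i" using True by linarith
      then have "0 < Rmul b i" using P_diag_pos[OF i] by (simp add: zero_less_mult_iff)
      then show ?thesis by (rule src[OF i])
    qed
  qed
  then show "S = {..<n}" using S by auto
qed

text \<open>The hypothesis on ranks concerns \<open>A\<close> alone; it is transferred to
  \<open>P\<close> and \<open>L\<close>, which makes the iteration terminate. Linear convergence
  then holds with any ratio, here 1/2.\<close>

lemma geometric_of_rank:
  fixes rank :: "nat \<Rightarrow> nat"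
  assumes dom: "dominating xs"
    and diag: "\<And>i. i < n \<Longrightarrow> P i i = A (i # replicate r i)"
    and rank: "\<And>i is j. i < n \<Longrightarrow> is \<in> tuples n r \<Longrightarrow> is \<noteq> replicate r i \<Longrightarrow> A (i # is) \<noteq> 0 \<Longrightarrow>
      j \<in> set is \<Longrightarrow> rank j < rank i"
  shows "geometric xs"
proof -
  \<comment> \<open>With the whole diagonal in \<open>P\<close>, the diagonal elements of
    \<open>L\<close> vanish. Elsewhere \<open>P\<close> and \<open>- L\<close> are both nonpositive,
    so nothing cancels and a nonzero element of either one shows up in \<open>A\<close>.\<close>
  have L0: "A (i # is) \<noteq> 0 \<and> is \<noteq> replicate r i" if "i < n" "is \<in> tuples n r" "L (i # is) \<noteq> 0" for i "is"
  proof (cases "\<exists>j. is = replicate r j")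
    case True
    then obtain j where j: "is = replicate r j" by blast
    then have jn: "j < n" using that(2) r_pos by (simp add: tuples_def)
    have "j \<noteq> i" using that j A_replicate[OF that(1,1)] diag[OF that(1)] by auto
    then show ?thesis
      using P_off[OF that(1) jn] L_nonneg[OF that(1,2)] that(3) A_replicate[OF that(1) jn] j r_pos
      by (auto simp: replicate_eq_replicate)
  qed (use A_other[OF that(1,2)] that in auto)
  have rank_P: "rank j < rank i" if "i < n" "j < n" "j \<noteq> i" "P i j \<noteq> 0" for i j
  proof (rule rank[OF that(1), of "replicate r j"])
    have "replicate r j \<in> tuples n r" using that by (auto simp: tuples_def)
    then show "A (i # replicate r j) \<noteq> 0"
      using that P_off[of i j] L_nonneg[of i "replicate r j"] A_replicate[of i j] by auto
  qed (use that r_pos in \<open>auto simp: tuples_def replicate_eq_replicate\<close>)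
  have eq: "x k i = xs i" if "i < n" "k0 + rank i < k" for i k
    by (rule eventually_eq_of_rank[where rank = rank and xs = xs, OF rank_P _ _ _ that])
      (use L0 rank dom splitting in \<open>auto simp: dominating_def intro: less_imp_le\<close>)
  define K where "K = Suc (k0 + (\<Sum>i<n. rank i))"
  define X where "X = 1 + (\<Sum>i<n. xs i)"
  have X: "xs i \<le> X" "rank i \<le> (\<Sum>i<n. rank i)" if "i < n" for i
    using member_le_sum[of i "{..<n}" xs] member_le_sum[of i "{..<n}" rank] that dom
    by (auto simp: X_def dominating_def less_imp_le)
  have Xpos: "0 < X"
    unfolding X_def using sum_nonneg[of "{..<n}" xs] dom by (simp add: less_imp_le add_pos_nonneg dominating_def)
  \<comment> \<open>From index \<open>K\<close> on the error is zero; before that it is at most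
    \<open>X\<close>, and \<open>2 ^ K * (1 / 2) ^ k\<close> is at least 1.\<close>
  have "\<bar>x k i - xs i\<bar> \<le> (X * 2 ^ K) * (1 / 2) ^ k" if k: "k0 \<le> k" and i: "i < n" for k i
  proof (cases "k < K")
    case True
    have "\<bar>x k i - xs i\<bar> \<le> X * 1"
      using x_nonneg[OF k i] X[OF i] dom k i by (auto simp: dominating_def)
    also have "\<dots> \<le> X * (2 ^ K * (1 / 2) ^ k)"
      using True Xpos power_increasing[of k K "2::real"]
      by (intro mult_left_mono) (auto simp: power_divide pos_le_divide_eq)
    finally show ?thesis by (simp add: mult.assoc)
  next
    case False
    then have "x k i = xs i" using X(2)[OF i] i by (intro eq) (auto simp: K_def)
    then show ?thesis using Xpos by simp
  qed
  then show ?thesis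
    unfolding geometric_def using Xpos by (intro exI[of _ "X * 2 ^ K"] exI[of _ "1 / 2"]) auto
qed

end

subsection \<open>The minimal nonnegative solution\<close>

locale tensor_equation = split_sequence n r P R L b 0 x A
  for n r P R L b x A +
  assumes x_0: "i < n \<Longrightarrow> x 0 i = 0"
    and feasible_nonempty: "\<exists>y. (\<forall>i<n. 0 \<le> y i) \<and> (\<forall>i<n. b i \<le> tensor_form n r A y i)"
begin

definition feasible :: "(nat \<Rightarrow> real) \<Rightarrow> bool" where
  "feasible y \<longleftrightarrow> (\<forall>i<n. 0 \<le> y i) \<and> (\<forall>i<n. b i \<le> tensor_form n r A y i)"

lemma x_le_feasible: "feasible y \<Longrightarrow> i < n \<Longrightarrow> x k i \<le> y i"
  by (rule x_le_supersolution[of y]) (auto simp: feasible_def splitting x_0)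

lemma x_le_Suc: "i < n \<Longrightarrow> x k i \<le> x (Suc k) i"
  by (rule x_mono) (simp_all add: x_0 x_nonneg)

lemma x_incseq: "i < n \<Longrightarrow> incseq (\<lambda>k. x k i)"
  by (simp add: incseq_SucI x_le_Suc)

definition xs :: "nat \<Rightarrow> real" where
  "xs i = lim (\<lambda>k. x k i)"

lemma x_tendsto: "i < n \<Longrightarrow> (\<lambda>k. x k i) \<longlonglongrightarrow> xs i"
proof -
  assume i: "i < n"
  obtain y where "feasible y"
    using feasible_nonempty by (auto simp: feasible_def)
  then have "\<And>k. x k i \<le> y i" using x_le_feasible i by blast
  then obtain l where "(\<lambda>k. x k i) \<longlonglongrightarrow> l"
    using incseq_convergent[OF x_incseq[OF i], of "y i"] by blast
  then show ?thesis by (simp add: xs_def limI)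
qed

lemma x_le_xs: "i < n \<Longrightarrow> x k i \<le> xs i"
  by (rule incseq_le[OF x_incseq x_tendsto])

lemma xs_nonneg: "i < n \<Longrightarrow> 0 \<le> xs i"
  using x_le_xs[of i 0] x_0 by simp

lemma xs_le_feasible: "feasible y \<Longrightarrow> i < n \<Longrightarrow> xs i \<le> y i"
  by (rule LIMSEQ_le_const2[OF x_tendsto]) (auto intro: x_le_feasible)

lemma xs_fixed: "i < n \<Longrightarrow> Pmul (\<lambda>j. xs j ^ r) i = T xs i + b i"
  by (rule limit_solution[OF x_tendsto])

lemma xs_solution: "i < n \<Longrightarrow> tensor_form n r A xs i = b i"
  using xs_fixed splitting[of i xs] by simp

lemma xs_le_solution:
  assumes "\<And>i. i < n \<Longrightarrow> 0 \<le> y i" "\<And>i. i < n \<Longrightarrow> tensor_form n r A y i = b i" "i < n"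
  shows "xs i \<le> y i"
  by (rule xs_le_feasible) (use assms in \<open>auto simp: feasible_def\<close>)

lemma x_pos_mono: "i < n \<Longrightarrow> 0 < x k i \<Longrightarrow> k \<le> l \<Longrightarrow> 0 < x l i"
  using incseqD[OF x_incseq] by (meson less_le_trans)

lemma x_1_pos:
  assumes "i < n" "0 < b i"
  shows "0 < x (Suc 0) i"
proof -
  have "0 \<le> T (x 0) j + b j" if "j < n" for j
    using that x_nonneg b_nonneg by (intro add_nonneg_nonneg T_nonneg) auto
  moreover have "0 < T (x 0) i + b i"
    using assms x_nonneg by (intro add_nonneg_pos T_nonneg) auto
  ultimately have "0 < x (Suc 0) i ^ r"
    unfolding x_Suc_pow[OF le0 assms(1)] by (rule Rmul_pos[OF _ assms(1)])
  then show ?thesis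
    using x_nonneg[of "Suc 0" i] assms(1) zero_power[OF r_pos, where 'a = real] by (metis le0 less_le)
qed

text \<open>If a diagonal element were nonpositive, zeroing that coordinate would keep feasibility.\<close>

lemma diag_pos:
  assumes "i < n" "0 < xs i"
  shows "0 < A (i # replicate r i)"
proof (rule ccontr)
  assume neg: "\<not> 0 < A (i # replicate r i)"
  define y where "y = xs(i := 0)"
  have y: "0 \<le> y j" "y j \<le> xs j" if "j < n" for j
    using that xs_nonneg assms by (auto simp: y_def)
  have "feasible y"
    unfolding feasible_def
  proof (intro conjI allI impI)
    fix l assume l: "l < n"
    have "tensor_form n r A xs l \<le> tensor_form n r A y l"
      unfolding tensor_form_def
    proof (rule sum_mono)
      fix js assume js: "js \<in> tuples n r"
      have le: "(\<Prod>k<r. y (js ! k)) \<le> (\<Prod>k<r. xs (js ! k))"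
        using y js by (intro prod_mono) (auto intro: tuples_nth)
      show "A (l # js) * (\<Prod>k<r. xs (js ! k)) \<le> A (l # js) * (\<Prod>k<r. y (js ! k))"
      \<comment> \<open>Only diagonal coefficients of rows \<open>l\<close> other than
        \<open>i\<close> can be positive, and their terms do not involve coordinate
        \<open>i\<close>. All other coefficients are nonpositive, so shrinking the product raises
        the term.\<close>
      proof (cases "js = replicate r l \<and> l \<noteq> i")
        case True
        then show ?thesis by (simp add: y_def)
      next
        case False
        then have "A (l # js) \<le> 0" using neg A_off[OF l js] by force
        then show ?thesis using le by (rule mult_left_mono_neg[rotated])
      qed
    qed
    then show "b l \<le> tensor_form n r A y l" using xs_solution[OF l] by simp
  qed (rule y)
  then show False using xs_le_feasible[of y i] assms by (simp add: y_def)
qed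

text \<open>
  Solutions of the equations on the support of the minimal solution extend by zero: a row outside
  the support is a vanishing sum of nonpositive terms, so its coefficients on the support vanish.
\<close>

lemma xs_le_restricted_solution:
  assumes y: "\<And>i. i < n \<Longrightarrow> 0 \<le> y i" and y0: "\<And>i. i < n \<Longrightarrow> xs i = 0 \<Longrightarrow> y i = 0"
    and sol: "\<And>i. i < n \<Longrightarrow> 0 < xs i \<Longrightarrow> tensor_form n r A y i = b i"
    and "i < n"
  shows "xs i \<le> y i"
proof (rule xs_le_solution[OF y _ assms(4)])
  fix i assume i: "i < n"
  show "tensor_form n r A y i = b i"
  proof (cases "0 < xs i")
    case False
    then have xi: "xs i = 0" using xs_nonneg[OF i] by simp
    have le: "A (i # js) * (\<Prod>k<r. xs (js ! k)) \<le> 0" if js: "js \<in> tuples n r" for js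
    proof (cases "js = replicate r i")
      case True
      then show ?thesis using xi r_pos by (simp add: power_0_left)
    next
      case False
      have "0 \<le> (\<Prod>k<r. xs (js ! k))"
        using js by (intro prod_nonneg) (auto intro: xs_nonneg tuples_nth)
      then show ?thesis using A_off[OF i js False] by (rule mult_nonpos_nonneg[rotated])
    qed
    have s: "(\<Sum>js\<in>tuples n r. A (i # js) * (\<Prod>k<r. xs (js ! k))) = b i"
      using xs_solution[OF i] by (simp add: tensor_form_def)
    moreover have "(\<Sum>js\<in>tuples n r. A (i # js) * (\<Prod>k<r. xs (js ! k))) \<le> 0"
      by (rule sum_nonpos) (rule le)
    ultimately have bi: "b i = 0"
      using b_nonneg[OF i] by simp
    have zero: "A (i # js) * (\<Prod>k<r. xs (js ! k)) = 0" if js: "js \<in> tuples n r" for js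
      using sum_nonneg_eq_0_iff[of "tuples n r" "\<lambda>js. - (A (i # js) * (\<Prod>k<r. xs (js ! k)))"]
        le s bi js by (simp add: sum_negf)
    have "tensor_form n r A y i = 0"
      unfolding tensor_form_def
    proof (intro sum.neutral ballI)
      fix js assume js: "js \<in> tuples n r"
      show "A (i # js) * (\<Prod>k<r. y (js ! k)) = 0"
      proof (cases "A (i # js) = 0")
        case False
        then obtain k where k: "k < r" "xs (js ! k) = 0" using zero[OF js] by auto
        then have "y (js ! k) = 0" using y0[OF tuples_nth[OF js k(1)]] by simp
        then show ?thesis using k by auto
      qed simp
    qed
    then show ?thesis using bi by simp
  qed (use sol i in auto)
qed

definition pattern :: "nat \<Rightarrow> nat set" where
  "pattern k = {i. i < n \<and> x k i = 0}"

lemma finite_pattern [simp]: "finite (pattern k)"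
  by (simp add: pattern_def)

lemma x_pos_iff: "i < n \<Longrightarrow> 0 < x k i \<longleftrightarrow> i \<notin> pattern k"
  using x_nonneg[of k i] by (auto simp: pattern_def)

lemma pattern_antimono: "k \<le> l \<Longrightarrow> pattern l \<subseteq> pattern k"
  using x_pos_mono x_pos_iff by (fastforce simp: pattern_def)

lemma pattern_stable:
  assumes "pattern k1 = pattern (Suc k1)" "k1 \<le> k"
  shows "pattern k = pattern k1"
proof -
  have "0 < x k i \<longleftrightarrow> 0 < x k1 i" if "i < n" for i
    by (rule same_pattern_propagates) (use assms that in \<open>auto simp: x_pos_iff\<close>)
  then show ?thesis using x_pos_iff by (auto simp: pattern_def)
qed

text \<open>As long as the patterns keep changing, each step removes at least one index, so
  \<open>card (pattern k) + k\<close> stays at most \<open>n\<close>. The first step is always a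
  change, because \<open>j\<close> leaves the pattern there.\<close>

lemma pattern_stabilizes:
  assumes "j < n" "0 < b j"
  shows "\<exists>k0. pattern k0 = pattern (Suc k0) \<and> (\<forall>k<k0. pattern k \<noteq> pattern (Suc k)) \<and> 1 \<le> k0 \<and> k0 \<le> n"
proof -
  have decr: "card (pattern k) + k \<le> n" if "\<forall>l<k. pattern l \<noteq> pattern (Suc l)" for k
    using that
  proof (induction k)
    case 0
    have "pattern 0 \<subseteq> {..<n}" by (auto simp: pattern_def)
    then show ?case using card_mono[of "{..<n}" "pattern 0"] by simp
  next
    case (Suc k)
    then have "pattern (Suc k) \<subset> pattern k"
      using pattern_antimono[of k "Suc k"] by auto
    then have "card (pattern (Suc k)) < card (pattern k)"
      by (intro psubset_card_mono) auto
    then show ?case using Suc by auto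
  qed
  then have ex: "\<exists>k. pattern k = pattern (Suc k)"
    using not_less_eq_eq[of n n] by (metis add_leE order_refl)
  define k0 where "k0 = (LEAST k. pattern k = pattern (Suc k))"
  have k0: "pattern k0 = pattern (Suc k0)"
    unfolding k0_def using ex by (rule LeastI_ex)
  have min: "\<forall>k<k0. pattern k \<noteq> pattern (Suc k)"
    using not_less_Least unfolding k0_def by blast
  have "j \<in> pattern 0" "j \<notin> pattern (Suc 0)"
    using assms x_0 x_1_pos[OF assms] by (auto simp: pattern_def)
  then have "k0 \<noteq> 0" using k0 by (intro notI) simp
  then show ?thesis using k0 min decr[OF min] by (intro exI[of _ k0]) auto
qed

lemma xs_eq_0_iff:
  assumes "pattern k1 = pattern (Suc k1)" "i < n"
  shows "xs i = 0 \<longleftrightarrow> i \<in> pattern k1"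
proof
  assume "xs i = 0"
  then show "i \<in> pattern k1"
    using x_le_xs[OF assms(2), of k1] x_nonneg[of k1 i] assms(2) by (simp add: pattern_def)
next
  assume "i \<in> pattern k1"
  then have "\<forall>k\<ge>k1. x k i = 0"
    using pattern_stable[OF assms(1)] by (auto simp: pattern_def)
  then have "(\<lambda>k. x k i) \<longlonglongrightarrow> 0"
    by (intro tendsto_eventually) (auto simp: eventually_sequentially)
  then show "xs i = 0" using x_tendsto[OF assms(2)] LIMSEQ_unique by blast
qed

end

subsection \<open>Vectors, matrices and subtensors\<close>

text \<open>Collects what the iteration needs of the coefficients in a form that holds for the
  original data and is stable under restriction to an index set.\<close>

definition regular_splitting :: "nat \<Rightarrow> nat \<Rightarrow> real mat \<Rightarrow> tensor \<Rightarrow> tensor \<Rightarrow> bool" where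
  "regular_splitting n r P L A \<longleftrightarrow> semipositive_Z_mat n P \<and>
     (\<forall>i<n. \<forall>is\<in>tuples n r. 0 \<le> L (i # is)) \<and>
     (\<forall>i<n. \<forall>j<n. A (i # replicate r j) = P $$ (i, j) - L (i # replicate r j)) \<and>
     (\<forall>i<n. \<forall>is\<in>tuples n r. (\<forall>j. is \<noteq> replicate r j) \<longrightarrow> A (i # is) = - L (i # is))"

lemma regular_splitting_level1:
  assumes m: "2 \<le> m" and n: "1 \<le> n" and Z: "Z_tensor m n A"
    and P: "P \<in> carrier_mat n n" "nonsingular_M_matrix P"
    and Q: "Q \<in> carrier_mat n n" "0\<^sub>m n n \<le> Q" and maj: "majorization_mat m n A = P - Q"
  shows "regular_splitting n (m - 1) P (level1_L m A Q) A"
proof -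
  have r: "0 < m - 1" using m by simp
  have L_rep: "level1_L m A Q (i # replicate (m - 1) j) = Q $$ (i, j)" for i j
    using r by (auto simp: level1_L_def)
  have L_other: "level1_L m A Q (i # is) = - A (i # is)" if "\<And>j. is \<noteq> replicate (m - 1) j" for i "is"
    using that by (simp add: level1_L_def level1_N_def level1_M_def)
  have A_rep: "A (i # replicate (m - 1) j) = P $$ (i, j) - Q $$ (i, j)" if "i < n" "j < n" for i j
    using arg_cong[OF maj, of "\<lambda>M. M $$ (i, j)"] that P Q by (simp add: majorization_mat_def)
  have Q_nonneg: "0 \<le> Q $$ (i, j)" if "i < n" "j < n" for i j
    using Q that by (auto simp: less_eq_mat_def)
  have "0 \<le> level1_L m A Q (i # is)" if i: "i < n" and js: "is \<in> tuples n (m - 1)" for i "is"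
  proof (cases "\<exists>j. is = replicate (m - 1) j")
    case True
    then obtain j where j: "is = replicate (m - 1) j" by blast
    then have "j < n" using js r by (simp add: tuples_def)
    then show ?thesis using j L_rep Q_nonneg i by simp
  next
    case False
    have "i # is \<in> tuples n m" using i js m by (auto simp: tuples_def)
    moreover have "\<nexists>j. i # is = replicate m j" using False m by (cases m) auto
    ultimately have "A (i # is) \<le> 0" using Z by (auto simp: Z_tensor_def)
    then show ?thesis using L_other False by simp
  qed
  then show ?thesis
    unfolding regular_splitting_def
    using nonsingular_M_matrix_semipositive[OF P(2,1)] n A_rep L_rep L_other by auto
qed

section \<open>Restriction of tensors and splittings to an index set\<close>

lemma map_pick_tuples:
  assumes "J \<subseteq> {..<n}" "is \<in> tuples (card J) r"
  shows "map (pick J) is \<in> tuples n r" "set (map (pick J) is) \<subseteq> J"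
  using assms pick_in_set_le[of _ J] by (auto simp: tuples_def subset_iff)

lemma bij_betw_map_pick:
  assumes J: "J \<subseteq> {..<n}"
  shows "bij_betw (map (pick J)) (tuples (card J) r) {is \<in> tuples n r. set is \<subseteq> J}"
proof -
  have fin: "finite J" using J finite_subset by blast
  note bij = bij_betw_pick[OF fin]
  have "inj_on (map (pick J)) (tuples (card J) r)"
    by (rule inj_onI, rule map_inj_on[where f = "pick J"])
      (use bij in \<open>auto simp: tuples_def bij_betw_def intro: inj_on_subset\<close>)
  moreover have "map (pick J) ` tuples (card J) r = {is \<in> tuples n r. set is \<subseteq> J}"
  proof (intro equalityI subsetI)
    fix js assume "js \<in> {is \<in> tuples n r. set is \<subseteq> J}"
    then have js: "length js = r" "set js \<subseteq> J" by (auto simp: tuples_def)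
    let ?g = "inv_into {..<card J} (pick J)"
    have "map (pick J) (map ?g js) = js"
      using js(2) bij by (auto simp: map_idI bij_betw_def f_inv_into_f subset_iff)
    moreover have "map ?g js \<in> tuples (card J) r"
      using js bij inv_into_into[of _ "pick J" "{..<card J}"]
      by (auto simp: tuples_def bij_betw_def subset_iff)
    ultimately show "js \<in> map (pick J) ` tuples (card J) r" by (metis imageI)
  next
    fix js assume "js \<in> map (pick J) ` tuples (card J) r"
    then show "js \<in> {is \<in> tuples n r. set is \<subseteq> J}"
      using map_pick_tuples[OF J] by blast
  qed
  ultimately show ?thesis by (simp add: bij_betw_def)
qed

text \<open>Every term with an index outside \<open>J\<close> contains a zero factor, and the
  remaining tuples are enumerated by \<open>pick J\<close>.\<close>

lemma tensor_form_subtensor: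
  assumes J: "J \<subseteq> {..<n}" and r: "0 < r"
    and y: "\<And>j. j < n \<Longrightarrow> j \<notin> J \<Longrightarrow> y j = 0"
  shows "tensor_form (card J) r (subtensor A J) (\<lambda>i. y (pick J i)) i = tensor_form n r A y (pick J i)"
proof -
  let ?f = "\<lambda>js. A (pick J i # js) * (\<Prod>k<r. y (js ! k))"
  have "tensor_form (card J) r (subtensor A J) (\<lambda>i. y (pick J i)) i
      = (\<Sum>is\<in>tuples (card J) r. ?f (map (pick J) is))"
    unfolding tensor_form_def subtensor_def
    by (intro sum.cong refl arg_cong2[where f = "(*)"] prod.cong) (auto simp: tuples_def)
  also have "\<dots> = sum ?f {is \<in> tuples n r. set is \<subseteq> J}"
    by (rule sum.reindex_bij_betw[OF bij_betw_map_pick[OF J]])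
  also have "\<dots> = sum ?f (tuples n r)"
  proof (rule sum.mono_neutral_left[OF finite_tuples], blast, rule ballI)
    fix js assume "js \<in> tuples n r - {is \<in> tuples n r. set is \<subseteq> J}"
    then have js: "js \<in> tuples n r" "\<not> set js \<subseteq> J" by auto
    then obtain k where k: "k < r" "js ! k \<notin> J"
      by (auto simp: tuples_def subset_iff in_set_conv_nth)
    then have "y (js ! k) = 0" using y tuples_nth[OF js(1) k(1)] by blast
    then show "?f js = 0" using k by auto
  qed
  finally show ?thesis by (simp add: tensor_form_def)
qed

lemma sum_submatrix_row:
  fixes P :: "real mat"
  assumes P: "P \<in> carrier_mat n n" and J: "J \<subseteq> {..<n}" and i: "i < card J"
    and y: "\<And>j. j < n \<Longrightarrow> j \<notin> J \<Longrightarrow> y j = 0"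
  shows "(\<Sum>j<card J. submatrix P J J $$ (i, j) * y (pick J j)) = (\<Sum>j<n. P $$ (pick J i, j) * y j)"
proof -
  have fin: "finite J" using J finite_subset by blast
  have "(\<Sum>j<card J. submatrix P J J $$ (i, j) * y (pick J j))
      = (\<Sum>j<card J. P $$ (pick J i, pick J j) * y (pick J j))"
    using submatrix_principal[OF P J] i by (intro sum.cong) auto
  also have "\<dots> = (\<Sum>j\<in>J. P $$ (pick J i, j) * y j)"
    by (rule sum_pick[OF fin])
  also have "\<dots> = (\<Sum>j<n. P $$ (pick J i, j) * y j)"
    by (rule sum.mono_neutral_left) (use J y in auto)
  finally show ?thesis .
qed

lemma regular_splitting_sub:
  assumes S: "regular_splitting n r P L A" and J: "J \<subseteq> {..<n}" and r: "0 < r"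
  shows "regular_splitting (card J) r (submatrix P J J) (subtensor L J) (subtensor A J)"
proof -
  have P: "semipositive_Z_mat n P" using S by (simp add: regular_splitting_def)
  then have Pc: "P \<in> carrier_mat n n" by (simp add: semipositive_Z_mat_def)
  have fin: "finite J" using J finite_subset by blast
  \<comment> \<open>Injectivity of \<open>pick J\<close> keeps nonconstant tuples nonconstant, so
    the two kinds of positions in the splitting are not mixed up by renumbering.\<close>
  have not_rep: "\<forall>j. map (pick J) is \<noteq> replicate r j"
    if js: "is \<in> tuples (card J) r" and nr: "\<forall>j. is \<noteq> replicate r j" for "is"
  proof (rule ccontr, simp)
    assume "\<exists>j. map (pick J) is = replicate r j"
    then obtain j where j: "map (pick J) is = replicate r j" by blast
    have len: "length is = r" using js by (simp add: tuples_def)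
    have eq0: "is ! k = is ! 0" if k: "k < r" for k
    proof -
      have "pick J (is ! k) = pick J (is ! 0)"
        using arg_cong[OF j, of "\<lambda>l. l ! k"] arg_cong[OF j, of "\<lambda>l. l ! 0"] k r len by simp
      then show ?thesis
        using bij_betw_pick[OF fin] tuples_nth[OF js k] tuples_nth[OF js r]
        by (auto simp: bij_betw_def inj_on_def)
    qed
    have "is = replicate r (is ! 0)"
    proof (rule nth_equalityI)
      fix k assume "k < length is"
      then have k: "k < r" by (simp only: len)
      show "is ! k = replicate r (is ! 0) ! k"
        using eq0[OF k] by (simp only: nth_replicate[OF k])
    qed (simp add: len)
    then show False using nr by blast
  qed
  show ?thesis
    unfolding regular_splitting_def
  proof (intro conjI allI impI ballI)
    show "semipositive_Z_mat (card J) (submatrix P J J)"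
      by (rule semipositive_Z_submatrix[OF P J])
    fix i assume i: "i < card J"
    note pi = pick_less[OF J i]
    show "0 \<le> subtensor L J (i # is)" if "is \<in> tuples (card J) r" for "is"
      using S map_pick_tuples[OF J that] pi by (simp add: subtensor_def regular_splitting_def)
    show "subtensor A J (i # replicate r j) = submatrix P J J $$ (i, j) - subtensor L J (i # replicate r j)"
      if "j < card J" for j
      using S submatrix_principal(2)[OF Pc J i that] pi pick_less[OF J that]
      by (simp add: subtensor_def regular_splitting_def)
    show "subtensor A J (i # is) = - subtensor L J (i # is)"
      if "is \<in> tuples (card J) r" "\<forall>j. is \<noteq> replicate r j" for "is"
      using S map_pick_tuples[OF J that(1)] not_rep[OF that] pi
      by (simp add: subtensor_def regular_splitting_def)
  qed
qed

section \<open>Translation between vectors and coordinate functions\<close>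

lemma tensor_vec_index:
  "i < n \<Longrightarrow> tensor_vec m n A v $ i = tensor_form n (m - 1) A (\<lambda>j. v $ j) i"
  by (simp add: tensor_vec_def tensor_form_def)

lemma tensor_vec_carrier [simp]: "tensor_vec m n A v \<in> carrier_vec n"
  by (simp add: tensor_vec_def)

lemma zero_le_vec_iff: "v \<in> carrier_vec n \<Longrightarrow> 0\<^sub>v n \<le> v \<longleftrightarrow> (\<forall>i<n. 0 \<le> v $ i)"
  by (auto simp: less_eq_vec_def)

lemma tensor_vec_eq_iff:
  "b \<in> carrier_vec n \<Longrightarrow> tensor_vec m n A v = b \<longleftrightarrow>
     (\<forall>i<n. tensor_form n (m - 1) A (\<lambda>j. v $ j) i = b $ i)"
  using tensor_vec_carrier[of m n A v] by (auto simp: vec_eq_iff tensor_vec_index)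

lemma iteration_from_iff:
  assumes P: "P \<in> carrier_mat n n" and b: "b \<in> carrier_vec n"
  shows "iteration_from k0 u m n P L b x \<longleftrightarrow> x k0 = u \<and>
    (\<forall>k\<ge>k0. x k \<in> carrier_vec n \<and> (\<forall>i<n. 0 \<le> x k $ i)) \<and>
    (\<forall>k\<ge>k0. \<forall>i<n. (\<Sum>j<n. P $$ (i, j) * x (Suc k) $ j ^ (m - 1))
        = tensor_form n (m - 1) L (\<lambda>j. x k $ j) i + b $ i)"
proof -
  have step: "P *\<^sub>v vec_power w (m - 1) = tensor_vec m n L v + b \<longleftrightarrow>
      (\<forall>i<n. (\<Sum>j<n. P $$ (i, j) * w $ j ^ (m - 1)) = tensor_form n (m - 1) L (\<lambda>j. v $ j) i + b $ i)"
    if w: "w \<in> carrier_vec n" for v w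
  proof -
    have pw: "vec_power w (m - 1) \<in> carrier_vec n" using w by (simp add: vec_power_def)
    have "(P *\<^sub>v vec_power w (m - 1)) $ i = (\<Sum>j<n. P $$ (i, j) * w $ j ^ (m - 1))" if "i < n" for i
      unfolding mult_mat_vec_sum[OF P pw that] using w by (intro sum.cong) (auto simp: vec_power_def)
    moreover have "dim_vec (P *\<^sub>v vec_power w (m - 1)) = n" using P by simp
    ultimately show ?thesis
      using b by (auto simp: vec_eq_iff tensor_vec_index)
  qed
  show ?thesis
  proof
    assume it: "iteration_from k0 u m n P L b x"
    then have c: "x k \<in> carrier_vec n" "x (Suc k) \<in> carrier_vec n" if "k0 \<le> k" for k
      using that by (auto simp: iteration_from_def)
    show "x k0 = u \<and> (\<forall>k\<ge>k0. x k \<in> carrier_vec n \<and> (\<forall>i<n. 0 \<le> x k $ i)) \<and>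
      (\<forall>k\<ge>k0. \<forall>i<n. (\<Sum>j<n. P $$ (i, j) * x (Suc k) $ j ^ (m - 1))
        = tensor_form n (m - 1) L (\<lambda>j. x k $ j) i + b $ i)"
      using it step[OF c(2)] zero_le_vec_iff[OF c(1)] by (auto simp: iteration_from_def)
  next
    assume it: "x k0 = u \<and> (\<forall>k\<ge>k0. x k \<in> carrier_vec n \<and> (\<forall>i<n. 0 \<le> x k $ i)) \<and>
      (\<forall>k\<ge>k0. \<forall>i<n. (\<Sum>j<n. P $$ (i, j) * x (Suc k) $ j ^ (m - 1))
        = tensor_form n (m - 1) L (\<lambda>j. x k $ j) i + b $ i)"
    then have c: "x k \<in> carrier_vec n" "x (Suc k) \<in> carrier_vec n" if "k0 \<le> k" for k
      using that by auto
    show "iteration_from k0 u m n P L b x"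
      unfolding iteration_from_def using it step[OF c(2)] zero_le_vec_iff[OF c(1)] by blast
  qed
qed

lemma iteration_from_sequence:
  assumes S: "regular_splitting n (m - 1) P L A" and m: "2 \<le> m"
    and b: "b \<in> carrier_vec n" "0\<^sub>v n \<le> b" and it: "iteration_from k0 u m n P L b x"
  shows "split_sequence n (m - 1) (\<lambda>i j. P $$ (i, j)) (\<lambda>i j. mat_inv P $$ (i, j)) L (\<lambda>i. b $ i)
    k0 (\<lambda>k i. x k $ i) A"
proof -
  have P: "semipositive_Z_mat n P" "P \<in> carrier_mat n n"
    using S by (auto simp: regular_splitting_def semipositive_Z_mat_def)
  interpret monotone_iteration n "m - 1" "\<lambda>i j. P $$ (i, j)" "\<lambda>i j. mat_inv P $$ (i, j)" L "\<lambda>i. b $ i"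
    by (rule semipositive_monotone_iteration[OF P(1)])
      (use S m b in \<open>auto simp: regular_splitting_def zero_le_vec_iff\<close>)
  show ?thesis
    using it S unfolding iteration_from_iff[OF P(2) b(1)]
    by unfold_locales (auto simp: Pmul_def regular_splitting_def)
qed

text \<open>The previous iterate determines the powers through \<open>R\<close>, and nonnegative
  roots are unique. This is what identifies any solution of the reduced recursion with the
  restricted iterates.\<close>

lemma iteration_from_unique:
  assumes S: "regular_splitting n (m - 1) P L A" and m: "2 \<le> m"
    and b: "b \<in> carrier_vec n" "0\<^sub>v n \<le> b"
    and x: "iteration_from k0 u m n P L b x" and y: "iteration_from k0 u m n P L b y"
    and "k0 \<le> k"
  shows "x k = y k"
  using assms(7)
proof (induction k rule: dec_induct)
  case base
  show ?case using x y by (simp add: iteration_from_def)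
next
  case (step k)
  interpret X: split_sequence n "m - 1" "\<lambda>i j. P $$ (i, j)" "\<lambda>i j. mat_inv P $$ (i, j)" L "\<lambda>i. b $ i"
    k0 "\<lambda>k i. x k $ i" A
    by (rule iteration_from_sequence[OF S m b x])
  interpret Y: split_sequence n "m - 1" "\<lambda>i j. P $$ (i, j)" "\<lambda>i j. mat_inv P $$ (i, j)" L "\<lambda>i. b $ i"
    k0 "\<lambda>k i. y k $ i" A
    by (rule iteration_from_sequence[OF S m b y])
  have k: "k0 \<le> Suc k" using step by simp
  have "x (Suc k) $ i = y (Suc k) $ i" if i: "i < n" for i
    using X.x_Suc_pow[OF step(1) i] Y.x_Suc_pow[OF step(1) i] step(3)
      X.x_nonneg[OF k i] Y.x_nonneg[OF k i] X.r_pos power_eq_imp_eq_base by metis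
  moreover have "x (Suc k) \<in> carrier_vec n" "y (Suc k) \<in> carrier_vec n"
    using x y k by (auto simp: iteration_from_def)
  ultimately show ?case by (auto simp: vec_eq_iff)
qed

section \<open>Euclidean norm and linear convergence\<close>

lemma eucl_norm_nonneg: "0 \<le> eucl_norm v"
  by (simp add: eucl_norm_def scalar_prod_def sum_nonneg)

text \<open>The crude factor \<open>n + 1\<close> in place of the root of \<open>n\<close> stays
  positive for \<open>n = 0\<close>, so it can be part of a convergence constant.\<close>

lemma eucl_norm_le:
  assumes "v \<in> carrier_vec n" "0 \<le> c" "\<And>i. i < n \<Longrightarrow> \<bar>v $ i\<bar> \<le> c"
  shows "eucl_norm v \<le> (real n + 1) * c"
proof -
  have "v \<bullet> v = (\<Sum>i<n. (v $ i)\<^sup>2)"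
    using assms(1) by (simp add: scalar_prod_def power2_eq_square atLeast0LessThan)
  also have "\<dots> \<le> (\<Sum>i<n. c\<^sup>2)"
    using assms by (intro sum_mono abs_le_square_iff[THEN iffD1]) auto
  also have "\<dots> \<le> ((real n + 1) * c)\<^sup>2"
    using assms(2) by (simp add: power_mult_distrib power2_eq_square algebra_simps)
  finally show ?thesis
    unfolding eucl_norm_def using assms(2) by (intro real_le_lsqrt) auto
qed

lemma linearly_convergent_fromI:
  assumes "\<And>k. k0 \<le> k \<Longrightarrow> x k \<in> carrier_vec n" "l \<in> carrier_vec n"
    and "0 < C" "0 < \<rho>" "\<rho> < 1" "\<And>k i. k0 \<le> k \<Longrightarrow> i < n \<Longrightarrow> \<bar>x k $ i - l $ i\<bar> \<le> C * \<rho> ^ k"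
  shows "linearly_convergent_from k0 x l"
  unfolding linearly_convergent_from_def
proof (intro exI conjI allI impI)
  fix k assume k: "k0 \<le> k"
  have "eucl_norm (x k - l) \<le> (real n + 1) * (C * \<rho> ^ k)"
    using assms k by (intro eucl_norm_le) (auto intro: minus_carrier_vec)
  then show "eucl_norm (x k - l) \<le> ((real n + 1) * C) * \<rho> ^ k" by (simp add: mult.assoc)
qed (use assms in auto)

lemma linearly_convergent_from_cong:
  assumes "\<And>k. k0 \<le> k \<Longrightarrow> eucl_norm (x k - l) = eucl_norm (y k - l')"
  shows "linearly_convergent_from k0 x l \<longleftrightarrow> linearly_convergent_from k0 y l'"
  using assms by (simp add: linearly_convergent_from_def)

text \<open>The finitely many early errors, each divided by its power of \<open>r\<close>, are added
  to the constant.\<close>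

lemma linearly_convergent_from_0:
  "linearly_convergent_from 0 x l \<longleftrightarrow> linearly_convergent_from k0 x l"
proof
  assume "linearly_convergent_from k0 x l"
  then obtain C r where C: "0 < C" "0 < r" "r < 1" "\<And>k. k0 \<le> k \<Longrightarrow> eucl_norm (x k - l) \<le> C * r ^ k"
    by (auto simp: linearly_convergent_from_def)
  define D where "D = C + (\<Sum>k<k0. eucl_norm (x k - l) / r ^ k)"
  have sum: "0 \<le> (\<Sum>k<k0. eucl_norm (x k - l) / r ^ k)"
    using C by (intro sum_nonneg divide_nonneg_pos eucl_norm_nonneg) auto
  have "eucl_norm (x k - l) \<le> D * r ^ k" for k
  proof (cases "k0 \<le> k")
    case True
    have "C * r ^ k \<le> D * r ^ k"
      using sum C by (intro mult_right_mono) (auto simp: D_def)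
    then show ?thesis using C(4)[OF True] by simp
  next
    case False
    have "eucl_norm (x k - l) / r ^ k \<le> (\<Sum>k<k0. eucl_norm (x k - l) / r ^ k)"
      using False C eucl_norm_nonneg by (intro member_le_sum) auto
    then have "eucl_norm (x k - l) / r ^ k \<le> D" using C by (simp add: D_def)
    then show ?thesis using C by (simp add: pos_divide_le_eq)
  qed
  then show "linearly_convergent_from 0 x l"
    unfolding linearly_convergent_from_def using C sum
    by (intro exI[of _ D] exI[of _ r]) (auto simp: D_def)
qed (auto simp: linearly_convergent_from_def)

subsection \<open>Semi-symmetrization\<close>

lemma tensor_mat_semi_symmetric_index:
  assumes "i < n" "j < n"
  shows "tensor_mat m n (semi_symmetric m C) (ones_vec n) $$ (i, j) =
    (\<Sum>is\<in>tuples n (m - 2). (\<Sum>\<sigma> | \<sigma> permutes {..<m - 1}. C (i # permute_list \<sigma> (j # is))) / fact (m - 1))"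
proof -
  have one: "(\<Prod>k<m - 2. ones_vec n $ (is ! k)) = 1" if "is \<in> tuples n (m - 2)" for "is"
    using tuples_nth[OF that] by (intro prod.neutral) (auto simp: ones_vec_def)
  show ?thesis
    using assms one by (simp add: tensor_mat_def semi_symmetric_def)
qed

lemma permute_list_tuples:
  assumes "\<sigma> permutes {..<r}" "js \<in> tuples n r"
  shows "permute_list \<sigma> js \<in> tuples n r" "set (permute_list \<sigma> js) = set js"
  using assms by (auto simp: tuples_def)

text \<open>Entry \<open>(i, j)\<close> is a combination of elements of row \<open>i\<close> whose
  remaining indices contain \<open>j\<close>: permuting positions does not change the set of
  indices.\<close>

lemma semi_symmetric_nonzeroD:
  assumes m: "2 \<le> m" and "i < n" "j < n"
    and nz: "tensor_mat m n (semi_symmetric m C) (ones_vec n) $$ (i, j) \<noteq> 0"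
  shows "\<exists>is\<in>tuples n (m - 1). j \<in> set is \<and> C (i # is) \<noteq> 0"
proof -
  obtain js where js: "js \<in> tuples n (m - 2)"
      "(\<Sum>\<sigma> | \<sigma> permutes {..<m - 1}. C (i # permute_list \<sigma> (j # js))) / fact (m - 1) \<noteq> 0"
    using nz sum.not_neutral_contains_not_neutral[of _ "tuples n (m - 2)"]
    unfolding tensor_mat_semi_symmetric_index[OF assms(2,3)] by blast
  then have "(\<Sum>\<sigma> | \<sigma> permutes {..<m - 1}. C (i # permute_list \<sigma> (j # js))) \<noteq> 0" by auto
  then obtain \<sigma> where \<sigma>: "\<sigma> permutes {..<m - 1}" "C (i # permute_list \<sigma> (j # js)) \<noteq> 0"
    using sum.not_neutral_contains_not_neutral[of _ "{\<sigma>. \<sigma> permutes {..<m - 1}}"] by blast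
  have "j # js \<in> tuples n (m - 1)" using js m assms(3) by (auto simp: tuples_def)
  then show ?thesis using permute_list_tuples[OF \<sigma>(1)] \<sigma>(2) by (metis list.set_intros(1))
qed

text \<open>For a nonnegative row there is no cancellation, so a zero entry \<open>(i, j)\<close>
  annihilates every element that contributes to it. Each tuple containing \<open>j\<close> does
  contribute, after \<open>j\<close> is moved to the front.\<close>

lemma semi_symmetric_zeroD:
  assumes m: "2 \<le> m" and i: "i < n"
    and C: "\<And>is. is \<in> tuples n (m - 1) \<Longrightarrow> 0 \<le> C (i # is)"
    and z: "tensor_mat m n (semi_symmetric m C) (ones_vec n) $$ (i, j) = 0"
    and js: "js \<in> tuples n (m - 1)" "j \<in> set js"
  shows "C (i # js) = 0"
proof -
  let ?r = "m - 1"
  have j: "j < n" by (rule tuples_mem[OF js])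
  have cons: "j # is \<in> tuples n ?r" if "is \<in> tuples n (m - 2)" for "is"
    using that m j by (auto simp: tuples_def)
  have nn: "0 \<le> C (i # permute_list \<sigma> (j # is))" if "\<sigma> permutes {..<?r}" "is \<in> tuples n (m - 2)" for \<sigma> "is"
    by (rule C[OF permute_list_tuples(1)[OF that(1) cons[OF that(2)]]])
  have "(\<Sum>\<sigma> | \<sigma> permutes {..<?r}. C (i # permute_list \<sigma> (j # is))) / fact ?r = 0"
    if "is \<in> tuples n (m - 2)" for "is"
    using z that nn unfolding tensor_mat_semi_symmetric_index[OF i j]
    by (subst (asm) sum_nonneg_eq_0_iff) (auto intro!: divide_nonneg_pos sum_nonneg)
  then have zero: "C (i # permute_list \<sigma> (j # is)) = 0"
    if "\<sigma> permutes {..<?r}" "is \<in> tuples n (m - 2)" for \<sigma> "is"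
    using that nn finite_permutations[of "{..<?r}"]
      sum_nonneg_eq_0_iff[of "{\<sigma>. \<sigma> permutes {..<?r}}" "\<lambda>\<sigma>. C (i # permute_list \<sigma> (j # is))"]
    by auto
  obtain p where p: "p < ?r" "js ! p = j"
    using js by (auto simp: tuples_def in_set_conv_nth)
  \<comment> \<open>The transposition brings \<open>j\<close> to the front; being an involution, it
    also leads back from the rearranged tuple to \<open>js\<close>.\<close>
  define \<sigma> where "\<sigma> = transpose 0 p"
  have \<sigma>: "\<sigma> permutes {..<?r}"
    unfolding \<sigma>_def using p by (intro permutes_swap_id) auto
  have len: "length js = ?r" using js by (simp add: tuples_def)
  obtain h t where ht: "permute_list \<sigma> js = h # t"
    using len p by (cases "permute_list \<sigma> js") (auto dest: arg_cong[where f = length])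
  have "h = permute_list \<sigma> js ! 0" by (simp add: ht)
  also have "\<dots> = j" using p len \<sigma> by (simp add: permute_list_nth \<sigma>_def)
  finally have h: "h = j" .
  have t: "t \<in> tuples n (m - 2)"
    using permute_list_tuples[OF \<sigma> js(1)] m unfolding ht by (auto simp: tuples_def)
  have "permute_list \<sigma> (j # t) = permute_list (\<sigma> \<circ> \<sigma>) js"
    using ht h \<sigma> len by (simp add: permute_list_compose)
  also have "\<dots> = js" by (simp add: \<sigma>_def)
  finally show ?thesis using zero[OF \<sigma> t] by simp
qed

subsection \<open>Proof of the theorem\<close>

text \<open>Conditions (a) to (d) in this order, for any system with a positive start and a positive
  solution above the iterates; it is applied to the reduced system.\<close>

lemma linear_convergence_criteria:
  assumes S: "regular_splitting n (m - 1) P L A" and m: "2 \<le> m"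
    and b: "b \<in> carrier_vec n" "0\<^sub>v n \<le> b" and bpos: "\<exists>j<n. b $ j \<noteq> 0"
    and it: "iteration_from k0 u m n P L b x"
    and xs: "xs \<in> carrier_vec n" "vec_pos xs" "tensor_vec m n A xs = b"
    and dom: "\<forall>k\<ge>k0. \<forall>i<n. x k $ i \<le> xs $ i" and start: "\<forall>i<n. 0 < x k0 $ i"
  shows "vec_pos (mat_inv P *\<^sub>v b) \<Longrightarrow> linearly_convergent_from k0 x xs"
    and "irreducible_mat (mat_inv P * tensor_mat m n (semi_symmetric m L) (ones_vec n)) \<Longrightarrow>
      linearly_convergent_from k0 x xs"
    and "\<lbrakk>\<forall>i<n. P $$ (i, i) = A (replicate m i);
      T = tensor_mat m n (semi_symmetric m (\<lambda>is. diag_part m A is - A is)) (ones_vec n);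
      strictly_upper_triangular T \<or> strictly_lower_triangular T\<rbrakk> \<Longrightarrow> linearly_convergent_from k0 x xs"
    and "(\<And>i. i < n \<Longrightarrow> b $ i = 0 \<Longrightarrow>
      \<exists>is\<in>tuples n (m - 1). (\<exists>j\<in>set is. b $ j \<noteq> 0) \<and> A (i # is) \<noteq> 0) \<Longrightarrow>
      linearly_convergent_from k0 x xs"
proof -
  interpret H: split_sequence n "m - 1" "\<lambda>i j. P $$ (i, j)" "\<lambda>i j. mat_inv P $$ (i, j)" L "\<lambda>i. b $ i"
    k0 "\<lambda>k i. x k $ i" A
    by (rule iteration_from_sequence[OF S m b it])
  have P: "semipositive_Z_mat n P" "P \<in> carrier_mat n n"
    using S by (auto simp: regular_splitting_def semipositive_Z_mat_def)
  note R = semipositive_Z_mat_inverse(1)[OF P(1)]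
  have D: "H.dominating (\<lambda>i. xs $ i)"
    unfolding H.dominating_def using xs dom start tensor_vec_eq_iff[OF b(1), of m A xs]
    by (auto simp: vec_pos_def)
  have linear: "linearly_convergent_from k0 x xs" if geo: "H.geometric (\<lambda>i. xs $ i)"
  proof -
    obtain C \<rho> where "0 < C" "0 < \<rho>" "\<rho> < 1"
      "\<And>k i. k0 \<le> k \<Longrightarrow> i < n \<Longrightarrow> \<bar>x k $ i - xs $ i\<bar> \<le> C * \<rho> ^ k"
      using geo unfolding H.geometric_def by blast
    then show ?thesis
      using it xs(1) by (intro linearly_convergent_fromI[of k0 x n xs C \<rho>]) (auto simp: iteration_from_def)
  qed
  show "linearly_convergent_from k0 x xs" if "vec_pos (mat_inv P *\<^sub>v b)"
  proof (rule linear, rule H.geometric_of_positive_source[OF D])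
    fix i assume i: "i < n"
    then have "0 < (mat_inv P *\<^sub>v b) $ i"
      using that R by (simp add: vec_pos_def)
    then show "0 < H.Rmul (\<lambda>i. b $ i) i"
      unfolding mult_mat_vec_sum[OF R b(1) i] H.Rmul_def .
  qed
  show "linearly_convergent_from k0 x xs"
    if irr: "irreducible_mat (mat_inv P * tensor_mat m n (semi_symmetric m L) (ones_vec n))"
  proof -
    let ?T = "tensor_mat m n (semi_symmetric m L) (ones_vec n)"
    have T: "?T \<in> carrier_mat n n" by (simp add: tensor_mat_def)
    obtain j0 where j0: "j0 < n" "0 < b $ j0"
      using bpos b by (force simp: less_eq_vec_def)
    show ?thesis
    proof (rule linear, rule H.geometric_of_irreducible[OF D j0])
      fix S :: "nat set" assume S: "S \<noteq> {}" "S \<subset> {..<n}"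
      have dim: "dim_row (mat_inv P * ?T) = n" using R by simp
      have "\<not> (\<forall>i\<in>S. \<forall>j\<in>{..<n} - S. (mat_inv P * ?T) $$ (i, j) = 0)"
        using irr S unfolding irreducible_mat_def dim by (metis (no_types))
      then obtain i j where ij: "i \<in> S" "j \<in> {..<n} - S" "(mat_inv P * ?T) $$ (i, j) \<noteq> 0"
        by blast
      then have i: "i < n" and j: "j < n" using S by auto
      obtain l where l: "l < n" "mat_inv P $$ (i, l) \<noteq> 0" "?T $$ (l, j) \<noteq> 0"
        using ij(3) sum.not_neutral_contains_not_neutral[of "\<lambda>l. mat_inv P $$ (i, l) * ?T $$ (l, j)" "{..<n}"]
        unfolding mult_mat_sum[OF R T i j] by auto
      show "\<exists>i\<in>S. \<exists>j\<in>{..<n} - S. \<exists>l<n. mat_inv P $$ (i, l) \<noteq> 0 \<and>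
          (\<exists>is\<in>tuples n (m - 1). j \<in> set is \<and> L (l # is) \<noteq> 0)"
        using ij l semi_symmetric_nonzeroD[OF m l(1) j l(3)] by blast
    qed
  qed
  show "linearly_convergent_from k0 x xs"
    if diag: "\<forall>i<n. P $$ (i, i) = A (replicate m i)"
      and T: "T = tensor_mat m n (semi_symmetric m (\<lambda>is. diag_part m A is - A is)) (ones_vec n)"
      and tri: "strictly_upper_triangular T \<or> strictly_lower_triangular T"
  proof -
    let ?B = "\<lambda>is. diag_part m A is - A is"
    have mr: "replicate m i = i # replicate (m - 1) i" for i
      using m by (cases m) auto
    have B_diag: "?B (i # replicate (m - 1) i) = 0" for i
      using mr[of i, symmetric] by (auto simp: diag_part_def)
    have B_off: "?B (i # is) = - A (i # is)" if "is \<noteq> replicate (m - 1) i" for i "is"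
      using that m by (auto simp: diag_part_def mr)
    have B_nonneg: "0 \<le> ?B (i # is)" if "i < n" "is \<in> tuples n (m - 1)" for i "is"
      using B_diag B_off H.A_off[OF that] by (cases "is = replicate (m - 1) i") auto
    \<comment> \<open>In the strictly upper triangular case row \<open>i\<close> refers to larger
      indices only, so the rank counts backwards; in the lower triangular case it is the index
      itself.\<close>
    obtain rank :: "nat \<Rightarrow> nat"
      where rank: "\<And>i j. i < n \<Longrightarrow> j < n \<Longrightarrow> \<not> rank j < rank i \<Longrightarrow> T $$ (i, j) = 0"
    proof (cases "strictly_upper_triangular T")
      case True
      show ?thesis
        by (rule that[of "\<lambda>i. n - i"]) (use True in \<open>auto simp: strictly_upper_triangular_def T tensor_mat_def\<close>)
    next
      case False
      then have "strictly_lower_triangular T" using tri by simp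
      then show ?thesis
        by (intro that[of "\<lambda>i. i"]) (auto simp: strictly_lower_triangular_def T tensor_mat_def)
    qed
    show ?thesis
    proof (rule linear, rule H.geometric_of_rank[OF D, of rank])
      show "P $$ (i, i) = A (i # replicate (m - 1) i)" if "i < n" for i
        unfolding mr[symmetric] using diag that by blast
      fix i j "is" assume *: "i < n" "is \<in> tuples n (m - 1)" "is \<noteq> replicate (m - 1) i" "A (i # is) \<noteq> 0" "j \<in> set is"
      show "rank j < rank i"
      proof (rule ccontr)
        assume "\<not> rank j < rank i"
        then have "T $$ (i, j) = 0"
          using * tuples_mem by (intro rank) auto
        then have "?B (i # is) = 0"
          using semi_symmetric_zeroD[OF m *(1), of ?B, OF B_nonneg[OF *(1)] _ *(2,5)] unfolding T by blast
        then show False using B_off * by simp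
      qed
    qed
  qed
  show "linearly_convergent_from k0 x xs"
    if "\<And>i. i < n \<Longrightarrow> b $ i = 0 \<Longrightarrow>
      \<exists>is\<in>tuples n (m - 1). (\<exists>j\<in>set is. b $ j \<noteq> 0) \<and> A (i # is) \<noteq> 0"
    by (rule linear, rule H.geometric_of_adjacent_source[OF D that])
qed

theorem theorem11:
  fixes m n :: nat and A L :: tensor and b :: "real vec" and P Q :: "real mat"
    and I0 :: "nat set" and x :: "nat \<Rightarrow> real vec"
  assumes "2 \<le> m" and "1 \<le> n"
    and "Z_tensor m n A"
    and "b \<in> carrier_vec n" and "0\<^sub>v n \<le> b"
    and "I0 = {i. i < n \<and> b $ i = 0}"
    and "{y \<in> carrier_vec n. 0\<^sub>v n \<le> y \<and> b \<le> tensor_vec m n A y} \<noteq> {}"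
    and "P \<in> carrier_mat n n" and "Q \<in> carrier_mat n n"
    and "majorization_mat m n A = P - Q"
    and "nonsingular_M_matrix P" and "0\<^sub>m n n \<le> Q"
    and "L = level1_L m A Q"
    and "iteration_from 0 (0\<^sub>v n) m n P L b x"
  shows
    "(I0 = {..<n} \<longrightarrow> min_nonneg_solution m n A b (x 0)) \<and>
     (I0 = {} \<longrightarrow>
       (\<exists>xmin. min_nonneg_solution m n A b xmin \<and> vec_pos xmin \<and>
          (\<forall>y\<in>carrier_vec n. vec_pos y \<and> tensor_vec m n A y = b \<longrightarrow> y = xmin) \<and>
          linearly_convergent_from 0 x xmin)) \<and>
     (I0 \<subset> {..<n} \<longrightarrow>
       (\<exists>k0 xmin.
          zero_pattern (x k0) = zero_pattern (x (Suc k0)) \<and>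
          (\<forall>k<k0. zero_pattern (x k) \<noteq> zero_pattern (x (Suc k))) \<and>
          1 \<le> k0 \<and> k0 \<le> n \<and>
          (\<forall>k\<ge>k0. zero_pattern (x k) = zero_pattern (x k0)) \<and>
          min_nonneg_solution m n A b xmin \<and>
          zero_pattern xmin = zero_pattern (x k0) \<and>
          (let I = zero_pattern (x k0);
               Ic = {..<n} - I;
               nh = card Ic;
               Ah = subtensor A Ic;
               bh = subvector b Ic;
               Ph = submatrix P Ic Ic;
               Lh = subtensor L Ic;
               I0h = I0 \<inter> Ic
           in I \<subseteq> I0 \<and>
              (\<forall>xh. iteration_from k0 (subvector (x k0) Ic) m nh Ph Lh bh xh \<longleftrightarrow>
                    (\<forall>k\<ge>k0. xh k = subvector (x k) Ic)) \<and>
              (\<exists>xhmin.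
                 min_nonneg_solution m nh Ah bh xhmin \<and> vec_pos xhmin \<and>
                 xhmin = subvector xmin Ic \<and>
                 (\<forall>i<nh. 0 < Ah (replicate m i)) \<and>
                 (\<forall>xh. iteration_from k0 (subvector (x k0) Ic) m nh Ph Lh bh xh \<longrightarrow>
                    (linearly_convergent_from 0 x xmin \<longleftrightarrow>
                     linearly_convergent_from k0 xh xhmin) \<and>
                    (vec_pos (mat_inv Ph *\<^sub>v bh) \<longrightarrow>
                     linearly_convergent_from k0 xh xhmin) \<and>
                    (irreducible_mat
                       (mat_inv Ph * tensor_mat m nh (semi_symmetric m Lh) (ones_vec nh)) \<longrightarrow>
                     linearly_convergent_from k0 xh xhmin) \<and>
                    ((\<forall>i<nh. Ph $$ (i, i) = Ah (replicate m i)) \<and>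
                     (let Bh = (\<lambda>is. diag_part m Ah is - Ah is);
                          T = tensor_mat m nh (semi_symmetric m Bh) (ones_vec nh)
                      in strictly_upper_triangular T \<or> strictly_lower_triangular T) \<longrightarrow>
                     linearly_convergent_from k0 xh xhmin) \<and>
                    ((\<forall>i\<in>I0h. \<exists>is. length is = m - 1 \<and> set is \<subseteq> Ic \<and>
                        (\<exists>j\<in>set is. j \<notin> I0) \<and> A (i # is) \<noteq> 0) \<longrightarrow>
                     linearly_convergent_from k0 xh xhmin))))))"
proof -
  let "(_ \<longrightarrow> ?part1) \<and> (_ \<longrightarrow> ?part2) \<and> (_ \<longrightarrow> ?part3)" = ?thesis
  note m = assms(1) and b = assms(4,5) and I0 = assms(6) and P = assms(8) and it = assms(14)
  have S: "regular_splitting n (m - 1) P L A"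
    unfolding assms(13) by (rule regular_splitting_level1) (use assms in auto)
  have r: "0 < m - 1" using m by simp
  have b_nonneg: "0 \<le> b $ i" if "i < n" for i
    using b that by (auto simp: less_eq_vec_def)
  have xc: "x k \<in> carrier_vec n" for k using it by (simp add: iteration_from_def)
  have x0: "x 0 = 0\<^sub>v n" using it by (simp add: iteration_from_def)
  interpret E: split_sequence n "m - 1" "\<lambda>i j. P $$ (i, j)" "\<lambda>i j. mat_inv P $$ (i, j)" L "\<lambda>i. b $ i"
    0 "\<lambda>k i. x k $ i" A
    by (rule iteration_from_sequence[OF S m b it])
  interpret E: tensor_equation n "m - 1" "\<lambda>i j. P $$ (i, j)" "\<lambda>i j. mat_inv P $$ (i, j)" L "\<lambda>i. b $ i"
    "\<lambda>k i. x k $ i" A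
  proof
    show "x 0 $ i = 0" if "i < n" for i using that x0 by simp
    obtain y where y: "y \<in> carrier_vec n" "0\<^sub>v n \<le> y" "b \<le> tensor_vec m n A y" using assms(7) by blast
    have "b $ i \<le> tensor_form n (m - 1) A (\<lambda>j. y $ j) i" if "i < n" for i
      using y(3) that tensor_vec_index[OF that, of m A y] by (auto simp: less_eq_vec_def tensor_vec_def)
    then show "\<exists>y. (\<forall>i<n. 0 \<le> y i) \<and> (\<forall>i<n. b $ i \<le> tensor_form n (m - 1) A y i)"
      using y by (intro exI[of _ "\<lambda>i. y $ i"]) (simp add: zero_le_vec_iff)
  qed
  define xmin where "xmin = vec n E.xs"
  have xmin: "xmin \<in> carrier_vec n" "\<And>i. i < n \<Longrightarrow> xmin $ i = E.xs i"
    by (auto simp: xmin_def)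
  have xmin_form: "tensor_form n (m - 1) A (\<lambda>j. xmin $ j) i = b $ i" if "i < n" for i
    using E.xs_solution[OF that] tensor_form_cong[of n "\<lambda>j. xmin $ j" E.xs] xmin(2) by simp
  have min_sol: "min_nonneg_solution m n A b xmin"
    unfolding min_nonneg_solution_def
  proof (intro conjI ballI impI)
    show "0\<^sub>v n \<le> xmin" using xmin E.xs_nonneg by (simp add: zero_le_vec_iff)
    show "tensor_vec m n A xmin = b" using xmin_form by (simp add: tensor_vec_eq_iff[OF b(1)])
    fix y assume y: "y \<in> carrier_vec n" "0\<^sub>v n \<le> y \<and> tensor_vec m n A y = b"
    have "E.xs i \<le> y $ i" if "i < n" for i
      by (rule E.xs_le_solution[OF _ _ that]) (use y in \<open>auto simp: zero_le_vec_iff tensor_vec_eq_iff[OF b(1)]\<close>)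
    then show "xmin \<le> y" using xmin y(1) by (auto simp: less_eq_vec_def)
  qed (rule xmin)
  have part1: ?part1 if "I0 = {..<n}"
  proof -
    have "b $ i = 0" if "i < n" for i using that \<open>I0 = {..<n}\<close> I0 by auto
    \<comment> \<open>For \<open>b = 0\<close> the zero vector is feasible, and the minimal solution
      lies below every feasible vector.\<close>
    then have "E.feasible (\<lambda>i. 0)"
      using r unfolding E.feasible_def by (simp add: tensor_form_def power_0_left)
    then have "E.xs i = 0" if "i < n" for i
      using E.xs_le_feasible[of "\<lambda>i. 0" i] E.xs_nonneg[OF that] that by simp
    then have "x 0 = xmin" unfolding x0 by (intro eq_vecI) (auto simp: xmin_def)
    then show ?thesis using min_sol by simp
  qed
  have part2: ?part2 if I0e: "I0 = {}"
  proof -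
    have bpos: "0 < b $ i" if "i < n" for i
      using that I0e I0 b_nonneg[OF that] by (auto simp: less_le)
    have x1: "0 < x 1 $ i" if "i < n" for i
      using E.x_1_pos[OF that bpos[OF that]] by simp
    \<comment> \<open>The contraction argument needs a positive start; \<open>x 0\<close> is zero,
      but \<open>b > 0\<close> makes \<open>x 1\<close> positive.\<close>
    have it1: "iteration_from 1 (x 1) m n P L b x" using it by (simp add: iteration_from_def)
    interpret F: split_sequence n "m - 1" "\<lambda>i j. P $$ (i, j)" "\<lambda>i j. mat_inv P $$ (i, j)" L "\<lambda>i. b $ i"
      1 "\<lambda>k i. x k $ i" A
      by (rule iteration_from_sequence[OF S m b it1])
    have R: "mat_inv P \<in> carrier_mat n n"
      using S by (intro semipositive_Z_mat_inverse(1)) (simp add: regular_splitting_def)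
    have vpos: "vec_pos xmin"
      using x1 E.x_le_xs xmin by (auto simp: vec_pos_def intro: less_le_trans)
    \<comment> \<open>Proved for every positive solution \<open>y\<close>: the iterates lie below
      each of them, hence converge to each of them, and uniqueness follows from uniqueness of
      limits.\<close>
    have geo: "F.geometric y" if y: "\<And>i. i < n \<Longrightarrow> 0 < y i" "\<And>i. i < n \<Longrightarrow> tensor_form n (m - 1) A y i = b $ i" for y
    proof (rule F.geometric_of_positive_source)
      have "E.feasible y" unfolding E.feasible_def using y by (auto intro: less_imp_le)
      then show "F.dominating y"
        unfolding F.dominating_def using x1 y E.x_le_feasible by auto
      show "0 < E.Rmul (\<lambda>i. b $ i) i" if "i < n" for i
        by (rule E.Rmul_pos[of "\<lambda>i. b $ i", OF b_nonneg that bpos[OF that]])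
    qed
    have uniq: "y = xmin" if y: "y \<in> carrier_vec n" "vec_pos y" "tensor_vec m n A y = b" for y
    proof -
      have "F.geometric (\<lambda>i. y $ i)"
        using y by (intro geo) (auto simp: vec_pos_def tensor_vec_eq_iff[OF b(1)])
      then obtain C \<rho> where C: "0 < \<rho>" "\<rho> < 1" "\<And>k i. 1 \<le> k \<Longrightarrow> i < n \<Longrightarrow> \<bar>x k $ i - y $ i\<bar> \<le> C * \<rho> ^ k"
        unfolding F.geometric_def by blast
      have "y $ i = E.xs i" if i: "i < n" for i
      proof (rule LIMSEQ_unique[OF _ E.x_tendsto[OF i]])
        have "(\<lambda>k. C * \<rho> ^ k) \<longlonglongrightarrow> C * 0"
          using C by (intro tendsto_intros LIMSEQ_realpow_zero) auto
        then have lim0: "(\<lambda>k. C * \<rho> ^ k) \<longlonglongrightarrow> 0" by simp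
        have "(\<lambda>k. x k $ i - y $ i) \<longlonglongrightarrow> 0"
        proof (rule tendsto_0_le[where K = 1])
          show "\<forall>\<^sub>F k in sequentially. norm (x k $ i - y $ i) \<le> norm (C * \<rho> ^ k) * 1"
            using C(3)[OF _ i] by (auto simp: eventually_sequentially intro!: exI[of _ 1] order_trans[OF _ abs_ge_self])
        qed (rule lim0)
        then show "(\<lambda>k. x k $ i) \<longlonglongrightarrow> y $ i" by (simp add: LIM_zero_iff)
      qed
      then show ?thesis using y(1) by (intro eq_vecI) (auto simp: xmin_def)
    qed
    have "F.geometric (\<lambda>i. xmin $ i)"
      using vpos xmin xmin_form by (intro geo) (auto simp: vec_pos_def)
    then have "linearly_convergent_from 1 x xmin"
      unfolding F.geometric_def using xc xmin(1) by (auto intro: linearly_convergent_fromI)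
    then show ?thesis
      using min_sol vpos uniq linearly_convergent_from_0[of x xmin 1] by blast
  qed
  have pat: "zero_pattern (x k) = E.pattern k" for k
    using xc[of k] by (auto simp: zero_pattern_def E.pattern_def)
  show ?thesis
  proof (intro conjI impI)
    assume "I0 \<subset> {..<n}"
    then obtain j0 where j0: "j0 < n" "0 < b $ j0"
      using I0 b_nonneg by (force simp: less_le)
    then obtain k0 where k0: "E.pattern k0 = E.pattern (Suc k0)" "\<forall>k<k0. E.pattern k \<noteq> E.pattern (Suc k)"
      "1 \<le> k0" "k0 \<le> n"
      using E.pattern_stabilizes by blast
    define J where "J = {..<n} - zero_pattern (x k0)"
    have J: "J \<subseteq> {..<n}" by (auto simp: J_def)
    then have fin: "finite J" using finite_subset by blast
    have x_out: "x k $ i = 0" if "k0 \<le> k" "i < n" "i \<notin> J" for k i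
      using that E.pattern_stable[OF k0(1) that(1)] pat by (auto simp: J_def E.pattern_def)
    have x_in: "0 < x k $ i" if "k0 \<le> k" "i \<in> J" for k i
      using that E.pattern_stable[OF k0(1) that(1)] pat E.x_pos_iff[of i k] by (auto simp: J_def)
    have xmin_out: "xmin $ i = 0" if "i < n" "i \<notin> J" for i
      using that E.xs_eq_0_iff[OF k0(1)] xmin pat by (auto simp: J_def)
    have xmin_in: "0 < xmin $ i" if "i \<in> J" for i
      using that E.xs_eq_0_iff[OF k0(1), of i] E.xs_nonneg[of i] xmin pat by (force simp: J_def)
    let ?nh = "card J" and ?Ah = "subtensor A J" and ?bh = "subvector b J"
    let ?Ph = "submatrix P J J" and ?Lh = "subtensor L J" and ?xm = "subvector xmin J"
    define y where "y k = subvector (x k) J" for k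
    note sub_x = subvector_index[OF xc J]
    note sub_b = subvector_index[OF b(1) J]
    note sub_m = subvector_index[OF xmin(1) J]
    note pJ = pick_less[OF J]
    have pick_J: "pick J i \<in> J" if "i < ?nh" for i using that by (rule pick_in_set_le)
    have Sh: "regular_splitting ?nh (m - 1) ?Ph ?Lh ?Ah"
      by (rule regular_splitting_sub[OF S J r])
    have bh: "?bh \<in> carrier_vec ?nh" "0\<^sub>v ?nh \<le> ?bh"
      using sub_b b_nonneg pJ by (auto simp: zero_le_vec_iff)
    have Ph: "?Ph \<in> carrier_mat ?nh ?nh" by (rule submatrix_principal(1)[OF P J])
    \<comment> \<open>Here \<open>1 \<le> k0\<close> enters: a coordinate with
      \<open>b $ i > 0\<close> is positive at index 1 and stays so.\<close>
    have I_sub: "zero_pattern (x k0) \<subseteq> I0"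
    proof
      fix i assume i: "i \<in> zero_pattern (x k0)"
      then have "i < n" "x k0 $ i = 0" using xc[of k0] by (auto simp: zero_pattern_def)
      moreover have "0 < b $ i \<Longrightarrow> 0 < x k0 $ i"
        using E.x_pos_mono[of i "Suc 0" k0] E.x_1_pos[of i] k0(3) \<open>i < n\<close> by simp
      ultimately show "i \<in> I0" using I0 b_nonneg[of i] by force
    qed
    \<comment> \<open>From \<open>k0\<close> on the coordinates outside \<open>J\<close> are zero in
      both consecutive iterates, so the rows in \<open>J\<close> lose nothing when the other columns
      and indices are deleted.\<close>
    have it_y: "iteration_from k0 (subvector (x k0) J) m ?nh ?Ph ?Lh ?bh y"
      unfolding iteration_from_iff[OF Ph bh(1)]
    proof (intro conjI allI impI)
      fix k assume k: "k0 \<le> k"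
      show "y k \<in> carrier_vec ?nh" unfolding y_def by (rule sub_x)
      fix i assume i: "i < ?nh"
      show "0 \<le> y k $ i" using i sub_x E.x_nonneg pJ by (simp add: y_def)
      have "(\<Sum>j<?nh. ?Ph $$ (i, j) * y (Suc k) $ j ^ (m - 1))
          = (\<Sum>j<?nh. ?Ph $$ (i, j) * x (Suc k) $ pick J j ^ (m - 1))"
        using sub_x by (intro sum.cong) (auto simp: y_def)
      also have "\<dots> = (\<Sum>j<n. P $$ (pick J i, j) * x (Suc k) $ j ^ (m - 1))"
        by (rule sum_submatrix_row[OF P J i]) (use x_out k r in \<open>auto simp: power_0_left\<close>)
      also have "\<dots> = tensor_form n (m - 1) L (\<lambda>j. x k $ j) (pick J i) + b $ pick J i"
        using E.x_step[of k "pick J i"] pJ[OF i] by (simp add: E.Pmul_def)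
      also have "tensor_form n (m - 1) L (\<lambda>j. x k $ j) (pick J i)
          = tensor_form ?nh (m - 1) ?Lh (\<lambda>j. x k $ pick J j) i"
        by (rule tensor_form_subtensor[OF J r, symmetric]) (use x_out k in auto)
      also have "\<dots> = tensor_form ?nh (m - 1) ?Lh (\<lambda>j. y k $ j) i"
        by (rule tensor_form_cong) (use sub_x in \<open>simp add: y_def\<close>)
      finally show "(\<Sum>j<?nh. ?Ph $$ (i, j) * y (Suc k) $ j ^ (m - 1))
          = tensor_form ?nh (m - 1) ?Lh (\<lambda>j. y k $ j) i + ?bh $ i"
        using sub_b i by simp
    qed (simp add: y_def)
    have it_iff: "iteration_from k0 (subvector (x k0) J) m ?nh ?Ph ?Lh ?bh xh \<longleftrightarrow>
        (\<forall>k\<ge>k0. xh k = subvector (x k) J)" for xh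
    proof
      assume "iteration_from k0 (subvector (x k0) J) m ?nh ?Ph ?Lh ?bh xh"
      then show "\<forall>k\<ge>k0. xh k = subvector (x k) J"
        using iteration_from_unique[OF Sh m bh _ it_y] by (auto simp: y_def)
    next
      assume "\<forall>k\<ge>k0. xh k = subvector (x k) J"
      then show "iteration_from k0 (subvector (x k0) J) m ?nh ?Ph ?Lh ?bh xh"
        using it_y by (simp add: iteration_from_def y_def)
    qed
    have xm_form: "tensor_form ?nh (m - 1) ?Ah (\<lambda>j. ?xm $ j) i = ?bh $ i" if i: "i < ?nh" for i
    proof -
      have "tensor_form ?nh (m - 1) ?Ah (\<lambda>j. ?xm $ j) i
          = tensor_form ?nh (m - 1) ?Ah (\<lambda>j. xmin $ pick J j) i"
        by (rule tensor_form_cong) (use sub_m in simp)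
      also have "\<dots> = tensor_form n (m - 1) A (\<lambda>j. xmin $ j) (pick J i)"
        by (rule tensor_form_subtensor[OF J r]) (use xmin_out in auto)
      finally show ?thesis using xmin_form[OF pJ[OF i]] sub_b i by simp
    qed
    have xm_pos: "vec_pos ?xm"
      using sub_m xmin_in pick_J by (auto simp: vec_pos_def)
    have min_h: "min_nonneg_solution m ?nh ?Ah ?bh ?xm"
      unfolding min_nonneg_solution_def
    proof (intro conjI ballI impI)
      show "?xm \<in> carrier_vec ?nh" by (rule sub_m)
      then show "0\<^sub>v ?nh \<le> ?xm" using xm_pos by (auto simp: zero_le_vec_iff vec_pos_def intro: less_imp_le)
      show "tensor_vec m ?nh ?Ah ?xm = ?bh" using xm_form by (simp add: tensor_vec_eq_iff[OF bh(1)])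
      fix v assume v: "v \<in> carrier_vec ?nh" "0\<^sub>v ?nh \<le> v \<and> tensor_vec m ?nh ?Ah v = ?bh"
      \<comment> \<open>Extension of \<open>v\<close> by zero. The number of elements of
        \<open>J\<close> below \<open>j\<close> is the position of \<open>j\<close> in
        \<open>J\<close>, so it inverts \<open>pick J\<close>.\<close>
      define w where "w j = (if j \<in> J then v $ card {a \<in> J. a < j} else 0)" for j
      have w_pick: "w (pick J i) = v $ i" if "i < ?nh" for i
        using that pick_J card_pick[of i J] by (simp add: w_def)
      have w_ex: "\<exists>i<?nh. j = pick J i" if "j \<in> J" for j
        using that bij_betw_pick[OF fin] by (auto simp: bij_betw_def)
      have "E.xs j \<le> w j" if "j < n" for j
      proof (rule E.xs_le_restricted_solution[OF _ _ _ that])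
        show "0 \<le> w i" for i
        proof (cases "i \<in> J")
          case True
          then obtain h where "h < ?nh" "i = pick J h" using w_ex by blast
          then show ?thesis using w_pick[of h] v by (simp add: zero_le_vec_iff)
        qed (simp add: w_def)
        show "w i = 0" if "i < n" "E.xs i = 0" for i
          using that xmin_in[of i] xmin(2) by (auto simp: w_def)
        show "tensor_form n (m - 1) A w i = b $ i" if i: "i < n" "0 < E.xs i" for i
        proof -
          have "i \<in> J" using i xmin_out[of i] xmin(2) by force
          then obtain h where h: "h < ?nh" "i = pick J h" using w_ex by blast
          have "tensor_form n (m - 1) A w (pick J h) = tensor_form ?nh (m - 1) ?Ah (\<lambda>j. w (pick J j)) h"
            by (rule tensor_form_subtensor[OF J r, symmetric]) (simp add: w_def)
          also have "\<dots> = tensor_form ?nh (m - 1) ?Ah (\<lambda>j. v $ j) h"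
            by (rule tensor_form_cong) (rule w_pick)
          also have "\<dots> = b $ pick J h"
            using v h(1) sub_b by (simp add: tensor_vec_eq_iff[OF bh(1)])
          finally show ?thesis by (simp add: h)
        qed
      qed
      then have "?xm $ i \<le> v $ i" if "i < ?nh" for i
        using w_pick[OF that] sub_m(2)[OF that] xmin(2)[OF pJ[OF that]] pJ[OF that] by metis
      then show "?xm \<le> v" using v(1) sub_m(1) by (auto simp: less_eq_vec_def)
    qed
    have diag: "0 < ?Ah (replicate m i)" if i: "i < ?nh" for i
    proof -
      have "replicate m a = a # replicate (m - 1) a" for a :: nat using m by (cases m) auto
      then show ?thesis
        using E.diag_pos[of "pick J i"] xmin_in[OF pick_J[OF i]] xmin(2) pJ[OF i]
        by (simp add: subtensor_def)
    qed
    \<comment> \<open>Outside \<open>J\<close> both vectors vanish, so the norms are equal; the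
      equivalence of the two linear convergences then needs only a shift of the starting
      index.\<close>
    have norm_eq: "eucl_norm (x k - xmin) = eucl_norm (y k - ?xm)" if k: "k0 \<le> k" for k
    proof -
      have "(x k - xmin) \<bullet> (x k - xmin) = (\<Sum>i<n. (x k $ i - xmin $ i) * (x k $ i - xmin $ i))"
        using xc[of k] xmin(1) by (simp add: scalar_prod_def atLeast0LessThan)
      also have "\<dots> = (\<Sum>i\<in>J. (x k $ i - xmin $ i) * (x k $ i - xmin $ i))"
        by (rule sum.mono_neutral_right) (use J x_out[OF k] xmin_out in auto)
      also have "\<dots> = (\<Sum>i<?nh. (x k $ pick J i - xmin $ pick J i) * (x k $ pick J i - xmin $ pick J i))"
        by (rule sum_pick[OF fin, symmetric])
      also have "\<dots> = (y k - ?xm) \<bullet> (y k - ?xm)"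
        using sub_x sub_m by (simp add: scalar_prod_def atLeast0LessThan y_def)
      finally show ?thesis by (simp add: eucl_norm_def)
    qed
    \<comment> \<open>The reduced right side is nonzero since \<open>j0\<close> is not in
      \<open>I0\<close>, while all deleted indices are. Criterion (b) needs this as its
      source.\<close>
    have bh_ne: "\<exists>j<?nh. ?bh $ j \<noteq> 0"
    proof -
      have "j0 \<in> J" using j0 I_sub I0 by (auto simp: J_def)
      then obtain h where "h < ?nh" "j0 = pick J h"
        using bij_betw_pick[OF fin] by (auto simp: bij_betw_def)
      then show ?thesis using j0 sub_b by auto
    qed
    have conv_all: "\<forall>xh. iteration_from k0 (subvector (x k0) J) m ?nh ?Ph ?Lh ?bh xh \<longrightarrow>
        (linearly_convergent_from 0 x xmin \<longleftrightarrow> linearly_convergent_from k0 xh ?xm) \<and>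
        (vec_pos (mat_inv ?Ph *\<^sub>v ?bh) \<longrightarrow> linearly_convergent_from k0 xh ?xm) \<and>
        (irreducible_mat (mat_inv ?Ph * tensor_mat m ?nh (semi_symmetric m ?Lh) (ones_vec ?nh)) \<longrightarrow>
           linearly_convergent_from k0 xh ?xm) \<and>
        ((\<forall>i<?nh. ?Ph $$ (i, i) = ?Ah (replicate m i)) \<and>
         (strictly_upper_triangular
            (tensor_mat m ?nh (semi_symmetric m (\<lambda>is. diag_part m ?Ah is - ?Ah is)) (ones_vec ?nh)) \<or>
          strictly_lower_triangular
            (tensor_mat m ?nh (semi_symmetric m (\<lambda>is. diag_part m ?Ah is - ?Ah is)) (ones_vec ?nh))) \<longrightarrow>
           linearly_convergent_from k0 xh ?xm) \<and>
        ((\<forall>i\<in>I0 \<inter> J. \<exists>is. length is = m - 1 \<and> set is \<subseteq> J \<and> (\<exists>j\<in>set is. j \<notin> I0) \<and> A (i # is) \<noteq> 0) \<longrightarrow>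
           linearly_convergent_from k0 xh ?xm)" (is "\<forall>xh. ?it xh \<longrightarrow> ?C xh")
    proof (intro allI impI)
      fix xh assume xh: "?it xh"
      have xh_y: "xh k = y k" if "k0 \<le> k" for k
        using it_iff[of xh] xh that by (simp add: y_def)
      have dom: "\<forall>k\<ge>k0. \<forall>i<?nh. xh k $ i \<le> ?xm $ i"
        using xh_y sub_x sub_m E.x_le_xs xmin(2) pJ by (simp add: y_def)
      have start: "\<forall>i<?nh. 0 < xh k0 $ i"
        using xh_y[of k0] sub_x x_in[of k0] pick_J by (simp add: y_def)
      have sol: "tensor_vec m ?nh ?Ah ?xm = ?bh" using min_h by (simp add: min_nonneg_solution_def)
      note crit = linear_convergence_criteria[OF Sh m bh bh_ne xh sub_m(1) xm_pos sol dom start]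
      have "linearly_convergent_from 0 x xmin \<longleftrightarrow> linearly_convergent_from k0 xh ?xm"
        unfolding linearly_convergent_from_0[of x xmin k0]
        by (rule linearly_convergent_from_cong) (simp add: norm_eq xh_y)
      moreover have "linearly_convergent_from k0 xh ?xm"
        if adj: "\<forall>i\<in>I0 \<inter> J. \<exists>is. length is = m - 1 \<and> set is \<subseteq> J \<and> (\<exists>j\<in>set is. j \<notin> I0) \<and> A (i # is) \<noteq> 0"
      proof (rule crit(4))
        fix i assume i: "i < ?nh" "?bh $ i = 0"
        then have "pick J i \<in> I0 \<inter> J" using I0 sub_b pJ pick_J by simp
        then obtain js j where js: "length js = m - 1" "set js \<subseteq> J" "j \<in> set js" "j \<notin> I0" "A (pick J i # js) \<noteq> 0"
          using adj by blast
        \<comment> \<open>Condition (d) names elements of the original tensor; its index tuple is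
          pulled back along \<open>pick J\<close> to a tuple of the reduced system.\<close>
        then have "js \<in> {is \<in> tuples n (m - 1). set is \<subseteq> J}" using J by (auto simp: tuples_def)
        then have "js \<in> map (pick J) ` tuples ?nh (m - 1)"
          by (simp only: bij_betw_imp_surj_on[OF bij_betw_map_pick[OF J]])
        then obtain hs where hs: "hs \<in> tuples ?nh (m - 1)" "js = map (pick J) hs"
          by blast
        then obtain h where h: "h \<in> set hs" "j = pick J h" using js(3) by auto
        have "h < ?nh" by (rule tuples_mem[OF hs(1) h(1)])
        then have "?bh $ h \<noteq> 0" using js(4) h I0 sub_b pJ by auto
        then show "\<exists>is\<in>tuples ?nh (m - 1). (\<exists>j\<in>set is. ?bh $ j \<noteq> 0) \<and> ?Ah (i # is) \<noteq> 0"
          using hs h js(5) by (intro bexI[of _ hs]) (auto simp: subtensor_def)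
      qed
      ultimately show "?C xh" using crit(1,2) crit(3)[OF _ refl] by blast
    qed
    have zp: "zero_pattern xmin = zero_pattern (x k0)"
      using E.xs_eq_0_iff[OF k0(1)] xmin pat by (auto simp: zero_pattern_def E.pattern_def)
    have zp_eq: "zero_pattern (x k0) = zero_pattern (x (Suc k0))"
      and zp_neq: "\<forall>k<k0. zero_pattern (x k) \<noteq> zero_pattern (x (Suc k))"
      and zp_const: "\<forall>k\<ge>k0. zero_pattern (x k) = zero_pattern (x k0)"
      using k0 E.pattern_stable[OF k0(1)] unfolding pat by blast+
    have it_all: "\<forall>xh. iteration_from k0 (subvector (x k0) J) m ?nh ?Ph ?Lh ?bh xh \<longleftrightarrow>
        (\<forall>k\<ge>k0. xh k = subvector (x k) J)"
      by (intro allI it_iff)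
    have diag_all: "\<forall>i<?nh. 0 < ?Ah (replicate m i)"
      by (intro allI impI diag)
    show ?part3
      unfolding Let_def
      by (rule exI[of _ k0], rule exI[of _ xmin], fold J_def)
        (intro conjI exI[of _ ?xm] zp_eq zp_neq zp_const k0(3,4) min_sol zp I_sub it_all min_h xm_pos refl
          diag_all conv_all)
  qed (fact part1, fact part2)
qed

end
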